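(* In the corrupted stochastic $K$-armed bandit described in the context, suppose $C_T\le K\,T^\beta$ for some $\beta\in(0,\tfrac12)$, and run the Regularized-EXP3 algorithm (fed with the observed corrupted losses) with mirror map $\phi_\alpha$, $\alpha\in[0,1]$, and parameters $\eta=1/\sqrt T$, $\varepsilon=\lambda=\frac1{\sqrt K}T^{-(\frac12-\beta)}$. Then the regret $\mathcal R(T)=\mathbb E\left[\sum_{t=1}^T\ell_{t,A_t}\right]-T\mu^\star$, with $\mu^\star=\min_j\mu_j$, satisfies $$\mathcal R(T)\le\begin{cases}\left(2\sqrt K\log T+2\log T\cdot T^\beta\right)\sqrt{KT}, &\alpha\in[0,\tfrac13),\\[2pt] \left(4\sqrt K\log K+2\log T\cdot T^\beta\right)\sqrt{KT}, &\alpha\in[\tfrac13,1].\end{cases}$$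
   Context: Corrupted stochastic $K$-armed bandit: at each round $t$ there is an underlying loss vector $\ell_t\in[0,1]^K$ whose coordinate $\ell_{t,a}$ is drawn from a distribution $\mathcal P_a$ on $[0,1]$ with mean $\mu_a$, independently across rounds. After $\ell_t$ is realized, an adversary produces $\ell^c_t\in[0,1]^K$; the learner picks $A_t$ and observes only $\ell^c_{t,A_t}$. Corruption level $C_T=\sum_{t=1}^T\mathbb E[\|\ell^c_t-\ell_t\|_\infty]$. $\Delta_\varepsilon=\{x\in\mathbb R^K: x_j\ge\varepsilon\ \forall j,\ \sum_jx_j=1\}$; $R_\varepsilon(x)=-\sum_i\ln x_i+\frac1\varepsilon\sum_ix_i$. Mirror maps on $\mathbb R^K_{>0}$: $\phi_\alpha(x)=-\sum_i\frac{x_i^\alpha-\alpha x_i-(1-\alpha)}{\alpha(1-\alpha)}$ for $0<\alpha<1$, $\phi_0(x)=-\sum_i(\log x_i-x_i+1)$, $\phi_1(x)=\sum_i(x_i\log x_i-x_i+1)$. $D_\phi(x,y)=\phi(x)-\phi(y)-\langle\nabla\phi(y),x-y\rangle$. Regularized-EXP3: $z_1=(1/K,\dots,1/K)$; for $t=1,\dots,T$: $x_t=\arg\min_{x\in\Delta_\varepsilon}D_\phi(x,z_t)$; draw $A_t$ with $\mathbb P(A_t=j\mid\text{past})=x_{t,j}$, observe $\ell^c_{t,A_t}$; $\widehat\ell_{t,j}=\mathbb I\{A_t=j\}\ell^c_{t,A_t}/x_{t,j}$; $\widetilde\ell_t=\widehat\ell_t+\lambda\nabla R_\varepsilon(x_t)$;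 $z_{t+1}=\arg\min_x\{\eta\langle\widetilde\ell_t,x\rangle+D_\phi(x,x_t)\}$.
   Formalization: The formal theorem adds the hypothesis Kε ≤ 1 (that is, √K ≤ T^{1/2−β}), which says exactly that Δ_ε is nonempty; otherwise (e.g. K=2, T=1) the projection x_t and hence the algorithm are undefined. *)

theory Defs
  imports "HOL-Probability.Probability"
begin

text \<open>Arms are 0..K-1; vectors in R^K are functions nat => real, extensional (0) outside {..<K}
  where relevant.\<close>

text \<open>Randomness of one round: (underlying loss vector l_t, learner's uniform u_t, adversary's uniform v_t).\<close>
type_synonym rnd = "(nat \<Rightarrow> real) \<times> real \<times> real"

definition phi1 :: "real \<Rightarrow> real \<Rightarrow> real" where
  "phi1 \<alpha> s = (if \<alpha> = 0 then - (ln s - s + 1)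
     else if \<alpha> = 1 then s * ln s - s + 1
     else - ((s powr \<alpha> - \<alpha> * s - (1 - \<alpha>)) / (\<alpha> * (1 - \<alpha>))))"

definition phi :: "nat \<Rightarrow> real \<Rightarrow> (nat \<Rightarrow> real) \<Rightarrow> real" where
  "phi K \<alpha> x = (\<Sum>i<K. phi1 \<alpha> (x i))"

definition pgrad :: "((nat \<Rightarrow> real) \<Rightarrow> real) \<Rightarrow> (nat \<Rightarrow> real) \<Rightarrow> nat \<Rightarrow> real" where
  "pgrad F x i = deriv (\<lambda>s. F (x(i := s))) (x i)"

definition bregman :: "nat \<Rightarrow> ((nat \<Rightarrow> real) \<Rightarrow> real) \<Rightarrow> (nat \<Rightarrow> real) \<Rightarrow> (nat \<Rightarrow> real) \<Rightarrow> real" where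
  "bregman K F x y = F x - F y - (\<Sum>i<K. pgrad F y i * (x i - y i))"

definition Reg :: "nat \<Rightarrow> real \<Rightarrow> (nat \<Rightarrow> real) \<Rightarrow> real" where
  "Reg K \<epsilon> x = - (\<Sum>i<K. ln (x i)) + (1 / \<epsilon>) * (\<Sum>i<K. x i)"

definition simplex_eps :: "nat \<Rightarrow> real \<Rightarrow> (nat \<Rightarrow> real) set" where
  "simplex_eps K \<epsilon> = {x. (\<forall>j<K. \<epsilon> \<le> x j) \<and> (\<Sum>j<K. x j) = 1 \<and> (\<forall>j. K \<le> j \<longrightarrow> x j = 0)}"

definition posorth :: "nat \<Rightarrow> (nat \<Rightarrow> real) set" where
  "posorth K = {x. (\<forall>j<K. 0 < x j) \<and> (\<forall>j. K \<le> j \<longrightarrow> x j = 0)}"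

definition proj :: "nat \<Rightarrow> ((nat \<Rightarrow> real) \<Rightarrow> real) \<Rightarrow> real \<Rightarrow> (nat \<Rightarrow> real) \<Rightarrow> (nat \<Rightarrow> real)" where
  "proj K F \<epsilon> z = (SOME x. x \<in> simplex_eps K \<epsilon> \<and>
       (\<forall>y\<in>simplex_eps K \<epsilon>. bregman K F x z \<le> bregman K F y z))"

definition mstep :: "nat \<Rightarrow> ((nat \<Rightarrow> real) \<Rightarrow> real) \<Rightarrow> real \<Rightarrow> (nat \<Rightarrow> real) \<Rightarrow> (nat \<Rightarrow> real) \<Rightarrow> (nat \<Rightarrow> real)" where
  "mstep K F \<eta> l x0 = (SOME z. z \<in> posorth K \<and>
       (\<forall>y\<in>posorth K. \<eta> * (\<Sum>i<K. l i * z i) + bregman K F z x0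
                        \<le> \<eta> * (\<Sum>i<K. l i * y i) + bregman K F y x0))"

text \<open>Inverse-CDF sampling: with u uniform on [0,1], P(sample K x u = j) = x j for x in the simplex.\<close>
definition sample :: "nat \<Rightarrow> (nat \<Rightarrow> real) \<Rightarrow> real \<Rightarrow> nat" where
  "sample K x u = (LEAST j. j = K - 1 \<or> u < (\<Sum>i\<le>j. x i))"

text \<open>z_t of Regularized-EXP3 (rounds indexed from 0), as a function of the randomness omega.
  adv t omega is the corrupted loss vector l^c_t.\<close>
primrec zst :: "nat \<Rightarrow> real \<Rightarrow> real \<Rightarrow> real \<Rightarrow> real \<Rightarrow> (nat \<Rightarrow> (nat \<Rightarrow> rnd) \<Rightarrow> nat \<Rightarrow> real)
                 \<Rightarrow> nat \<Rightarrow> (nat \<Rightarrow> rnd) \<Rightarrow> nat \<Rightarrow> real" where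
  "zst K \<alpha> \<eta> \<epsilon> lam adv 0 \<omega> = (\<lambda>i. if i < K then 1 / real K else 0)"
| "zst K \<alpha> \<eta> \<epsilon> lam adv (Suc t) \<omega> =
     (let x = proj K (phi K \<alpha>) \<epsilon> (zst K \<alpha> \<eta> \<epsilon> lam adv t \<omega>);
          a = sample K x (fst (snd (\<omega> t)));
          lt = (\<lambda>j. (if j = a then adv t \<omega> a / x j else 0) + lam * pgrad (Reg K \<epsilon>) x j)
      in mstep K (phi K \<alpha>) \<eta> lt x)"

definition xst :: "nat \<Rightarrow> real \<Rightarrow> real \<Rightarrow> real \<Rightarrow> real \<Rightarrow> (nat \<Rightarrow> (nat \<Rightarrow> rnd) \<Rightarrow> nat \<Rightarrow> real)
                 \<Rightarrow> nat \<Rightarrow> (nat \<Rightarrow> rnd) \<Rightarrow> nat \<Rightarrow> real" where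
  "xst K \<alpha> \<eta> \<epsilon> lam adv t \<omega> = proj K (phi K \<alpha>) \<epsilon> (zst K \<alpha> \<eta> \<epsilon> lam adv t \<omega>)"

definition act :: "nat \<Rightarrow> real \<Rightarrow> real \<Rightarrow> real \<Rightarrow> real \<Rightarrow> (nat \<Rightarrow> (nat \<Rightarrow> rnd) \<Rightarrow> nat \<Rightarrow> real)
                 \<Rightarrow> nat \<Rightarrow> (nat \<Rightarrow> rnd) \<Rightarrow> nat" where
  "act K \<alpha> \<eta> \<epsilon> lam adv t \<omega> = sample K (xst K \<alpha> \<eta> \<epsilon> lam adv t \<omega>) (fst (snd (\<omega> t)))"

end

theory Submission
  imports Defs
begin

text \<open>Write \<open>psi\<close> for the derivative of the mirror map, whose own derivative \<open>s powr (\<alpha> - 2)\<close> is at least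
  \<open>1 / s\<close> on \<open>(0, 1]\<close> for every \<open>\<alpha> \<le> 1\<close>; the analysis of a single round uses no more about \<open>\<alpha>\<close>.
  As \<open>\<lambda> = \<epsilon>\<close>, the regularizer adds \<open>1 - \<epsilon> / x\<close>, a number in \<open>[0, 1]\<close>, to each loss estimate, so all
  estimates are nonnegative and mirror descent gives, in every round, an error of at most
  \<open>\<eta> * (3 + 1 / x A)\<close> for the played arm \<open>A\<close>, where \<open>1 / x A\<close> has mean at most \<open>K\<close>. Comparing with the best arm
  mixed into the truncated simplex costs \<open>(K - 1) * \<epsilon>\<close> per round, as does the regularizer, and passing
  from corrupted to true losses costs twice the corruption. Together with
  a bound on the divergence from the uniform distribution, of order \<open>K ln T\<close> for \<open>\<alpha> < 1/3\<close> and
  \<open>K ln K\<close> otherwise, this proves the claim if \<open>ln T \<ge> 4\<close>; for smaller \<open>T\<close> and at least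
  two arms the claimed bound exceeds \<open>T\<close>.\<close>

section \<open>Mirror maps and Bregman projections\<close>

text \<open>The formula for \<open>\<alpha> < 1\<close> covers \<open>\<alpha> = 0\<close> too,
  where it reads \<open>1 - 1 / s\<close>. For every \<open>\<alpha>\<close> the value at 1 is
  0.\<close>

definition psi :: "real \<Rightarrow> real \<Rightarrow> real" where
  "psi \<alpha> s = (if \<alpha> = 1 then ln s else (1 - s powr (\<alpha> - 1)) / (1 - \<alpha>))"

lemma phi1_has_derivative:
  assumes "0 < s" "0 \<le> \<alpha>" "\<alpha> \<le> 1"
  shows "(phi1 \<alpha> has_real_derivative psi \<alpha> s) (at s)"
proof -
  consider "\<alpha> = 0" | "\<alpha> = 1" | "0 < \<alpha>" "\<alpha> < 1" using assms by linarith
  then show ?thesis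
  proof cases
    case 1
    have "((\<lambda>s. - (ln s - s + 1)) has_real_derivative (1 - 1 / s)) (at s)"
      using assms by (auto intro!: derivative_eq_intros)
    then show ?thesis using 1 assms unfolding phi1_def psi_def
      by (simp add: powr_minus_divide)
  next
    case 2
    have "((\<lambda>s. s * ln s - s + 1) has_real_derivative ln s) (at s)"
      using assms by (auto intro!: derivative_eq_intros)
    then show ?thesis using 2 unfolding phi1_def psi_def by simp
  next
    case 3
    have "((\<lambda>s. - ((s powr \<alpha> - \<alpha> * s - (1 - \<alpha>)) / (\<alpha> * (1 - \<alpha>)))) has_real_derivative
        - ((\<alpha> * s powr (\<alpha> - 1) - \<alpha>) / (\<alpha> * (1 - \<alpha>)))) (at s)"
      using assms 3 by (auto intro!: derivative_eq_intros)
    moreover have "- ((\<alpha> * s powr (\<alpha> - 1) - \<alpha>) / (\<alpha> * (1 - \<alpha>))) = (1 - s powr (\<alpha> - 1)) / (1 - \<alpha>)"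
      using 3 by (simp add: field_simps)
    ultimately show ?thesis using 3 unfolding phi1_def psi_def by simp
  qed
qed

lemma psi_has_derivative:
  assumes "0 < s"
  shows "(psi \<alpha> has_real_derivative s powr (\<alpha> - 2)) (at s)"
proof (cases "\<alpha> = 1")
  case True
  then show ?thesis using assms unfolding psi_def
    by (auto intro!: derivative_eq_intros simp: powr_minus_divide)
next
  case False
  have "((\<lambda>s. (1 - s powr (\<alpha> - 1)) / (1 - \<alpha>)) has_real_derivative
      (- ((\<alpha> - 1) * s powr (\<alpha> - 1 - 1)) / (1 - \<alpha>))) (at s)"
    using assms False by (auto intro!: derivative_eq_intros)
  moreover have "- ((\<alpha> - 1) * s powr (\<alpha> - 1 - 1)) / (1 - \<alpha>) = s powr (\<alpha> - 2)"
    using False by (simp add: field_simps)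
  ultimately show ?thesis using False unfolding psi_def by simp
qed

lemma psi_strict_mono:
  assumes "0 < x" "x < y"
  shows "psi \<alpha> x < psi \<alpha> y"
proof (rule DERIV_pos_imp_increasing[OF assms(2)])
  fix s assume "x \<le> s" "s \<le> y"
  then show "\<exists>d. (psi \<alpha> has_real_derivative d) (at s) \<and> 0 < d"
    using psi_has_derivative[of s \<alpha>] assms by (intro exI[of _ "s powr (\<alpha> - 2)"]) auto
qed

lemma psi_mono: "0 < x \<Longrightarrow> x \<le> y \<Longrightarrow> psi \<alpha> x \<le> psi \<alpha> y"
  using psi_strict_mono[of x y \<alpha>] by (cases "x = y") auto

text \<open>By the mean value theorem, since the slope \<open>s powr (\<alpha> - 2)\<close> is at
  least \<open>1 / s\<close>, hence at least \<open>1 / x\<close>, on \<open>[z, x]\<close>. A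
  decrease of the gradient by \<open>c\<close> therefore moves the point by at most
  \<open>c * x\<close>, whatever \<open>\<alpha>\<close> is.\<close>

lemma diff_le_psi_diff:
  assumes "0 < z" "z \<le> x" "x \<le> 1" "\<alpha> \<le> 1"
  shows "x - z \<le> (psi \<alpha> x - psi \<alpha> z) * x"
proof (cases "z = x")
  case False
  then have "z < x" using assms by simp
  have "\<exists>\<xi>>z. \<xi> < x \<and> psi \<alpha> x - psi \<alpha> z = (x - z) * (\<xi> powr (\<alpha> - 2))"
    using assms by (intro MVT2 \<open>z < x\<close> psi_has_derivative) auto
  then obtain \<xi> where \<xi>: "z < \<xi>" "\<xi> < x" "psi \<alpha> x - psi \<alpha> z = (x - z) * (\<xi> powr (\<alpha> - 2))"
    by blast
  have "1 / x \<le> \<xi> powr (-1)"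
    using \<xi> assms by (simp add: powr_minus_divide frac_le)
  also have "\<dots> \<le> \<xi> powr (\<alpha> - 2)"
    using \<xi> assms by (intro powr_mono') auto
  finally have "1 \<le> \<xi> powr (\<alpha> - 2) * x"
    using assms \<xi> by (simp add: field_simps)
  then have "(x - z) * 1 \<le> (x - z) * (\<xi> powr (\<alpha> - 2) * x)"
    using assms by (intro mult_left_mono) auto
  then show ?thesis using \<xi>(3) by (simp add: mult.assoc)
qed (use assms in auto)

text \<open>Bounding the factor \<open>x\<close> of \<open>diff_le_psi_diff\<close> by 1 leaves a
  slope of at least 1. This makes projections nonexpansive in the gradient.\<close>

lemma psi_strongly_monotone:
  assumes "0 < a" "a \<le> 1" "0 < b" "b \<le> 1" "\<alpha> \<le> 1"
  shows "(a - b)\<^sup>2 \<le> (psi \<alpha> a - psi \<alpha> b) * (a - b)"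
proof -
  have *: "(a - b)\<^sup>2 \<le> (psi \<alpha> a - psi \<alpha> b) * (a - b)"
    if ab: "0 < b" "b \<le> a" "a \<le> 1" for a b
  proof -
    have "a - b \<le> (psi \<alpha> a - psi \<alpha> b) * a" using diff_le_psi_diff[of b a] ab assms by auto
    also have "\<dots> \<le> (psi \<alpha> a - psi \<alpha> b) * 1"
      using psi_mono[of b a \<alpha>] ab by (intro mult_left_mono) auto
    finally show ?thesis
      using ab by (simp add: power2_eq_square mult_right_mono)
  qed
  show ?thesis
  proof (cases "b \<le> a")
    case False
    then have "(b - a)\<^sup>2 \<le> (psi \<alpha> b - psi \<alpha> a) * (b - a)" using *[of a b] assms by auto
    then show ?thesis by (simp add: power2_eq_square algebra_simps)
  qed (use * assms in auto)
qed

text \<open>Near 0 \<open>psi\<close> is unbounded below, so it can be decreased by any amount; for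
  \<open>\<alpha> < 1\<close> it is bounded above, so an arbitrary increase would not be attainable.
  Mirror steps thus exist because the loss estimates are nonnegative.\<close>

lemma psi_solve:
  assumes "0 < x" "0 \<le> c" "\<alpha> \<le> 1"
  obtains z where "0 < z" "z \<le> x" "psi \<alpha> z = psi \<alpha> x - c"
proof -
  have "\<exists>z>0. psi \<alpha> z = psi \<alpha> x - c"
  proof (cases "\<alpha> = 1")
    case True
    then show ?thesis using assms
      by (intro exI[of _ "x * exp (- c)"]) (simp add: psi_def ln_mult)
  next
    case False
    \<comment> \<open>Inverting the formula of \<open>psi\<close>: \<open>y\<close> is the value
      that \<open>z powr (\<alpha> - 1)\<close> must take.\<close>
    define y where "y = x powr (\<alpha> - 1) + (1 - \<alpha>) * c"
    have "0 < y" using assms unfolding y_def by (intro add_pos_nonneg) auto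
    then have "(y powr (1 / (\<alpha> - 1))) powr (\<alpha> - 1) = y"
      using False by (simp add: powr_powr)
    then show ?thesis using False \<open>0 < y\<close>
      by (intro exI[of _ "y powr (1 / (\<alpha> - 1))"]) (simp add: psi_def y_def field_simps)
  qed
  then obtain z where z: "0 < z" "psi \<alpha> z = psi \<alpha> x - c" by blast
  then have "z \<le> x" using psi_strict_mono[of x z \<alpha>] assms by force
  then show ?thesis using z that by blast
qed

definition breg1 :: "real \<Rightarrow> real \<Rightarrow> real \<Rightarrow> real" where
  "breg1 \<alpha> x y = phi1 \<alpha> x - phi1 \<alpha> y - psi \<alpha> y * (x - y)"

text \<open>Strict monotonicity of \<open>psi\<close> at an intermediate point. The strict form is
  what identifies the point chosen by \<open>mstep\<close>.\<close>

lemma breg1_pos: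
  assumes "0 < x" "0 < y" "x \<noteq> y" "0 \<le> \<alpha>" "\<alpha> \<le> 1"
  shows "0 < breg1 \<alpha> x y"
proof (cases "x < y")
  case True
  have "\<exists>\<xi>>x. \<xi> < y \<and> phi1 \<alpha> y - phi1 \<alpha> x = (y - x) * psi \<alpha> \<xi>"
    using assms by (intro MVT2 True phi1_has_derivative) auto
  then obtain \<xi> where \<xi>: "x < \<xi>" "\<xi> < y" "phi1 \<alpha> y - phi1 \<alpha> x = (y - x) * psi \<alpha> \<xi>" by blast
  have "(y - x) * psi \<alpha> \<xi> < (y - x) * psi \<alpha> y"
    using psi_strict_mono[of \<xi> y \<alpha>] \<xi> assms by (intro mult_strict_left_mono) auto
  then show ?thesis using \<xi>(3) by (simp add: breg1_def algebra_simps)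
next
  case False
  then have "y < x" using assms by simp
  have "\<exists>\<xi>>y. \<xi> < x \<and> phi1 \<alpha> x - phi1 \<alpha> y = (x - y) * psi \<alpha> \<xi>"
    using assms by (intro MVT2 \<open>y < x\<close> phi1_has_derivative) auto
  then obtain \<xi> where \<xi>: "y < \<xi>" "\<xi> < x" "phi1 \<alpha> x - phi1 \<alpha> y = (x - y) * psi \<alpha> \<xi>" by blast
  have "(x - y) * psi \<alpha> y < (x - y) * psi \<alpha> \<xi>"
    using psi_strict_mono[of y \<xi> \<alpha>] \<xi> assms by (intro mult_strict_left_mono) auto
  then show ?thesis using \<xi>(3) by (simp add: breg1_def algebra_simps)
qed

lemma breg1_nonneg:
  assumes "0 < x" "0 < y" "0 \<le> \<alpha>" "\<alpha> \<le> 1"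
  shows "0 \<le> breg1 \<alpha> x y"
  using breg1_pos[of x y \<alpha>] assms by (cases "x = y") (auto simp: breg1_def)

text \<open>The divergences in the two directions add up to
  \<open>(psi \<alpha> x - psi \<alpha> z) * (x - z)\<close>. Dropping the reverse one and bounding
  \<open>x - z\<close> by the gradient step leaves the local-norm term of mirror descent.\<close>

lemma breg1_dual_step_le:
  assumes "0 < z" "z \<le> x" "x \<le> 1" "0 \<le> \<alpha>" "\<alpha> \<le> 1"
  shows "breg1 \<alpha> x z \<le> (psi \<alpha> x - psi \<alpha> z)\<^sup>2 * x"
proof -
  have "breg1 \<alpha> x z + breg1 \<alpha> z x = (psi \<alpha> x - psi \<alpha> z) * (x - z)"
    by (simp add: breg1_def algebra_simps)
  then have "breg1 \<alpha> x z \<le> (psi \<alpha> x - psi \<alpha> z) * (x - z)"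
    using breg1_nonneg[of z x \<alpha>] assms by auto
  also have "\<dots> \<le> (psi \<alpha> x - psi \<alpha> z) * ((psi \<alpha> x - psi \<alpha> z) * x)"
    using psi_mono[of z x \<alpha>] assms by (intro mult_left_mono diff_le_psi_diff) auto
  finally show ?thesis by (simp add: power2_eq_square mult.assoc)
qed

section \<open>Gradients in several coordinates and the mirror step\<close>

lemma pgrad_phi:
  assumes "i < K" "0 < x i" "0 \<le> \<alpha>" "\<alpha> \<le> 1"
  shows "pgrad (phi K \<alpha>) x i = psi \<alpha> (x i)"
proof -
  have "phi K \<alpha> (x(i := s)) = phi1 \<alpha> s + (\<Sum>j\<in>{..<K} - {i}. phi1 \<alpha> (x j))" for s
    using assms unfolding phi_def by (subst sum.remove[of _ i]) (auto intro!: sum.cong)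
  moreover have "((\<lambda>s. phi1 \<alpha> s + (\<Sum>j\<in>{..<K} - {i}. phi1 \<alpha> (x j))) has_real_derivative
      psi \<alpha> (x i)) (at (x i))"
    using assms by (auto intro!: derivative_eq_intros phi1_has_derivative)
  ultimately show ?thesis unfolding pgrad_def by (simp add: DERIV_imp_deriv)
qed

lemma pgrad_Reg:
  assumes "i < K" "0 < x i"
  shows "pgrad (Reg K \<epsilon>) x i = 1 / \<epsilon> - 1 / x i"
proof -
  define c where "c = 1 / \<epsilon>"
  have "Reg K \<epsilon> (x(i := s)) = - (ln s + (\<Sum>j\<in>{..<K} - {i}. ln (x j)))
      + c * (s + (\<Sum>j\<in>{..<K} - {i}. x j))" for s
  proof -
    have "(\<Sum>j<K. ln ((x(i := s)) j)) = ln s + (\<Sum>j\<in>{..<K} - {i}. ln (x j))"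
      "(\<Sum>j<K. (x(i := s)) j) = s + (\<Sum>j\<in>{..<K} - {i}. x j)"
      using assms by (subst sum.remove[of _ i]; auto intro!: sum.cong)+
    then show ?thesis unfolding Reg_def c_def by simp
  qed
  moreover have "((\<lambda>s. - (ln s + (\<Sum>j\<in>{..<K} - {i}. ln (x j)))
      + c * (s + (\<Sum>j\<in>{..<K} - {i}. x j))) has_real_derivative (c - 1 / x i)) (at (x i))"
    using assms by (auto intro!: derivative_eq_intros)
  ultimately show ?thesis unfolding pgrad_def by (simp add: DERIV_imp_deriv c_def)
qed

lemma bregman_phi:
  assumes "\<And>i. i < K \<Longrightarrow> 0 < y i" "0 \<le> \<alpha>" "\<alpha> \<le> 1"
  shows "bregman K (phi K \<alpha>) x y = (\<Sum>i<K. breg1 \<alpha> (x i) (y i))"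
proof -
  have "(\<Sum>i<K. pgrad (phi K \<alpha>) y i * (x i - y i)) = (\<Sum>i<K. psi \<alpha> (y i) * (x i - y i))"
    using assms by (intro sum.cong refl) (simp add: pgrad_phi)
  then show ?thesis
    by (simp add: bregman_def breg1_def phi_def sum_subtractf)
qed

text \<open>The first-order condition splits into one equation per coordinate, solved by
  \<open>psi_solve\<close>. As the objective has only one minimizer, the choice operator in
  \<open>mstep\<close> must return this solution.\<close>

lemma mstep_phi:
  assumes x: "x \<in> posorth K" and "\<And>i. i < K \<Longrightarrow> 0 \<le> \<eta> * l i" and a: "0 \<le> \<alpha>" "\<alpha> \<le> 1"
  shows "mstep K (phi K \<alpha>) \<eta> l x \<in> posorth K"
    and "\<And>i. i < K \<Longrightarrow> psi \<alpha> (mstep K (phi K \<alpha>) \<eta> l x i) = psi \<alpha> (x i) - \<eta> * l i"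
proof -
  have xp: "0 < x i" if "i < K" for i using x that by (auto simp: posorth_def)
  have "\<forall>i. \<exists>z. i < K \<longrightarrow> 0 < z \<and> psi \<alpha> z = psi \<alpha> (x i) - \<eta> * l i"
    using psi_solve xp assms by metis
  then obtain z0 where z0: "\<And>i. i < K \<Longrightarrow> 0 < z0 i \<and> psi \<alpha> (z0 i) = psi \<alpha> (x i) - \<eta> * l i"
    by metis
  define z where "z = (\<lambda>i. if i < K then z0 i else 0)"
  have z: "z \<in> posorth K" using z0 by (auto simp: posorth_def z_def)
  have zpsi: "psi \<alpha> (z i) = psi \<alpha> (x i) - \<eta> * l i" "0 < z i" if "i < K" for i
    using z0 that by (auto simp: z_def)
  have breg: "bregman K (phi K \<alpha>) y x = (\<Sum>i<K. breg1 \<alpha> (y i) (x i))" for y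
    using xp a by (intro bregman_phi)
  define J where "J = (\<lambda>y. \<eta> * (\<Sum>i<K. l i * y i) + bregman K (phi K \<alpha>) y x)"
  \<comment> \<open>Since \<open>z\<close> is a critical point, the objective exceeds its value at \<open>z\<close> by exactly the
    divergence from \<open>z\<close>.\<close>
  have J: "J y - J z = (\<Sum>i<K. breg1 \<alpha> (y i) (z i))" for y
  proof -
    have "J y - J z = (\<Sum>i<K. \<eta> * l i * (y i - z i) + breg1 \<alpha> (y i) (x i) - breg1 \<alpha> (z i) (x i))"
      unfolding J_def breg
      by (simp add: sum.distrib sum_subtractf sum_distrib_left algebra_simps)
    also have "\<dots> = (\<Sum>i<K. breg1 \<alpha> (y i) (z i))"
      by (intro sum.cong refl) (simp add: breg1_def zpsi algebra_simps)
    finally show ?thesis .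
  qed
  have pos: "0 \<le> breg1 \<alpha> (y i) (z i)" if "y \<in> posorth K" "i < K" for y i
    using that zpsi a by (intro breg1_nonneg) (auto simp: posorth_def)
  have min: "J z \<le> J y" if "y \<in> posorth K" for y
  proof -
    have "0 \<le> (\<Sum>i<K. breg1 \<alpha> (y i) (z i))" using that by (intro sum_nonneg pos) auto
    then show ?thesis using J[of y] by simp
  qed
  have uniq: "y = z" if "y \<in> posorth K" "\<forall>u\<in>posorth K. J y \<le> J u" for y
  proof
    fix i
    have "(\<Sum>i<K. breg1 \<alpha> (y i) (z i)) \<le> 0" using J[of y] that(2) z by auto
    moreover have "0 \<le> (\<Sum>i<K. breg1 \<alpha> (y i) (z i))" using that by (intro sum_nonneg pos) auto
    ultimately have "(\<Sum>i<K. breg1 \<alpha> (y i) (z i)) = 0" by simp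
    then have eq0: "breg1 \<alpha> (y i) (z i) = 0" if "i < K" for i
      using pos[OF \<open>y \<in> posorth K\<close>] that by (subst (asm) sum_nonneg_eq_0_iff) auto
    show "y i = z i"
    proof (cases "i < K")
      case True
      then show ?thesis using eq0[OF True] breg1_pos[of "y i" "z i" \<alpha>] zpsi[OF True] that a
        by (force simp: posorth_def)
    qed (use that in \<open>auto simp: posorth_def z_def\<close>)
  qed
  have "mstep K (phi K \<alpha>) \<eta> l x = (SOME z. z \<in> posorth K \<and> (\<forall>y\<in>posorth K. J z \<le> J y))"
    unfolding mstep_def J_def ..
  also have "\<dots> = z"
    using z min uniq by (intro some_equality) blast+
  finally show "mstep K (phi K \<alpha>) \<eta> l x \<in> posorth K"
    "\<And>i. i < K \<Longrightarrow> psi \<alpha> (mstep K (phi K \<alpha>) \<eta> l x i) = psi \<alpha> (x i) - \<eta> * l i"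
    using z zpsi by auto
qed

section \<open>The truncated simplex and projections onto it\<close>

lemma simplex_epsD:
  assumes "x \<in> simplex_eps K \<epsilon>" "0 < \<epsilon>" "i < K"
  shows "\<epsilon> \<le> x i" "0 < x i" "x i \<le> 1"
proof -
  have "\<forall>j<K. 0 \<le> x j" using assms by (force simp: simplex_eps_def)
  then have "x i \<le> (\<Sum>j<K. x j)" using assms by (intro member_le_sum) auto
  then show "\<epsilon> \<le> x i" "0 < x i" "x i \<le> 1" using assms by (force simp: simplex_eps_def)+
qed

lemma simplex_eps_sum: "x \<in> simplex_eps K \<epsilon> \<Longrightarrow> (\<Sum>i<K. x i) = 1"
  by (simp add: simplex_eps_def)

lemma simplex_eps_convex:
  assumes "x \<in> simplex_eps K \<epsilon>" "y \<in> simplex_eps K \<epsilon>" "0 \<le> h" "h \<le> 1"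
  shows "(\<lambda>i. x i + h * (y i - x i)) \<in> simplex_eps K \<epsilon>"
proof -
  have "\<epsilon> \<le> x i + h * (y i - x i)" if "i < K" for i
  proof -
    have "(1 - h) * \<epsilon> + h * \<epsilon> \<le> (1 - h) * x i + h * y i"
      using assms that by (intro add_mono mult_left_mono) (auto simp: simplex_eps_def)
    then show ?thesis by (simp add: algebra_simps)
  qed
  moreover have "(\<Sum>i<K. x i + h * (y i - x i)) = 1"
    using assms by (simp add: sum.distrib sum_distrib_left[symmetric] sum_subtractf simplex_eps_def)
  ultimately show ?thesis using assms by (auto simp: simplex_eps_def)
qed

text \<open>Vectors are functions on all of \<open>nat\<close>, so the topology is the product
  topology: the set is a closed part of a cube that is compact by Tychonoff's theorem.\<close>

lemma compact_simplex_eps: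
  assumes "0 < \<epsilon>"
  shows "compact (simplex_eps K \<epsilon>)"
proof -
  have "compactin (product_topology (\<lambda>_. euclidean) UNIV) (PiE UNIV (\<lambda>_::nat. {0..1::real}))"
    by (subst compactin_PiE) auto
  then have "compact (PiE UNIV (\<lambda>_::nat. {0..1::real}))"
    by (simp add: euclidean_product_topology)
  moreover have "closed (simplex_eps K \<epsilon>)"
    unfolding simplex_eps_def
    by (intro closed_Collect_conj closed_Collect_all closed_Collect_imp closed_Collect_le
        closed_Collect_eq continuous_intros open_Collect_const continuous_on_product_coordinates)
  moreover have "simplex_eps K \<epsilon> \<subseteq> PiE UNIV (\<lambda>_. {0..1})"
  proof
    fix x assume x: "x \<in> simplex_eps K \<epsilon>"
    have "0 \<le> x i \<and> x i \<le> 1" for i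
      using simplex_epsD[OF x assms, of i] x by (cases "i < K") (auto simp: simplex_eps_def)
    then show "x \<in> PiE UNIV (\<lambda>_. {0..1})" by auto
  qed
  ultimately show ?thesis by (metis compact_Int_closed inf.absorb_iff2)
qed

lemma uniform_in_simplex_eps:
  assumes "1 \<le> K" "real K * \<epsilon> \<le> 1"
  shows "(\<lambda>i. if i < K then 1 / real K else 0) \<in> simplex_eps K \<epsilon>"
  using assms by (auto simp: simplex_eps_def field_simps)

text \<open>The optimality condition for \<open>x\<close> to be the Bregman projection of the point with gradient \<open>w\<close>. It
  makes sense, and has a solution, even if \<open>w\<close> is not a gradient; solutions are nonexpansive in
  \<open>w\<close>, and this is why the iterates are measurable.\<close>

definition dual_proj :: "nat \<Rightarrow> real \<Rightarrow> real \<Rightarrow> (nat \<Rightarrow> real) \<Rightarrow> (nat \<Rightarrow> real) \<Rightarrow> bool" where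
  "dual_proj K \<alpha> \<epsilon> w x \<longleftrightarrow> x \<in> simplex_eps K \<epsilon> \<and>
     (\<forall>y\<in>simplex_eps K \<epsilon>. 0 \<le> (\<Sum>i<K. (psi \<alpha> (x i) - w i) * (y i - x i)))"

text \<open>Along the segment from the minimizer to \<open>y\<close> the objective cannot start to
  decrease, so its one-sided derivative is nonnegative. Truncation keeps the coordinates positive,
  where \<open>phi1\<close> is differentiable.\<close>

lemma dual_proj_if_minimizer:
  assumes x: "x \<in> simplex_eps K \<epsilon>"
    and min: "\<And>y. y \<in> simplex_eps K \<epsilon> \<Longrightarrow>
      phi K \<alpha> x - (\<Sum>i<K. w i * x i) \<le> phi K \<alpha> y - (\<Sum>i<K. w i * y i)"
    and a: "0 < \<epsilon>" "0 \<le> \<alpha>" "\<alpha> \<le> 1"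
  shows "dual_proj K \<alpha> \<epsilon> w x"
  unfolding dual_proj_def
proof (intro conjI ballI x)
  fix y assume y: "y \<in> simplex_eps K \<epsilon>"
  define f where "f = (\<lambda>h. phi K \<alpha> (\<lambda>i. x i + h * (y i - x i)) - (\<Sum>i<K. w i * (x i + h * (y i - x i))))"
  define d where "d = (\<Sum>i<K. (psi \<alpha> (x i) - w i) * (y i - x i))"
  have 1: "((\<lambda>h. phi1 \<alpha> (x i + h * (y i - x i))) has_real_derivative
      psi \<alpha> (x i) * (y i - x i)) (at 0)" if "i < K" for i
  proof -
    have "(phi1 \<alpha> has_real_derivative psi \<alpha> (x i)) (at (x i + 0 * (y i - x i)))"
      using simplex_epsD[OF x _ that] a by (simp add: phi1_has_derivative)
    moreover have "((\<lambda>h. x i + h * (y i - x i)) has_real_derivative (y i - x i)) (at 0)"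
      by (auto intro!: derivative_eq_intros)
    ultimately show ?thesis by (rule DERIV_chain2)
  qed
  have "(f has_real_derivative (\<Sum>i<K. psi \<alpha> (x i) * (y i - x i)) - (\<Sum>i<K. w i * (y i - x i))) (at 0)"
    unfolding f_def phi_def
    by (intro derivative_intros 1) (auto intro!: derivative_eq_intros 1)
  then have df: "(f has_real_derivative d) (at 0)"
    by (simp add: d_def sum_subtractf left_diff_distrib)
  show "0 \<le> d"
  proof (rule ccontr)
    assume "\<not> 0 \<le> d"
    then obtain r where r: "r > 0" "\<And>h. 0 < h \<Longrightarrow> h < r \<Longrightarrow> f (0 + h) < f 0"
      using DERIV_neg_dec_right[OF df] by auto
    \<comment> \<open>At most 1 to stay on the segment, and below \<open>r\<close> to stay where
      \<open>f\<close> lies under its initial value.\<close>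
    define h where "h = min (r / 2) 1"
    have "f h < f 0" using r(2)[of h] r(1) by (auto simp: h_def)
    moreover have "f 0 \<le> f h"
      unfolding f_def using min[OF simplex_eps_convex[OF x y, of h]] r(1) by (auto simp: h_def)
    ultimately show False by simp
  qed
qed

lemma continuous_on_phi_minus_linear:
  assumes a: "0 < \<epsilon>" "0 \<le> \<alpha>" "\<alpha> \<le> 1"
  shows "continuous_on (simplex_eps K \<epsilon>) (\<lambda>x. phi K \<alpha> x - (\<Sum>i<K. w i * x i))"
proof -
  have "continuous_on (simplex_eps K \<epsilon>) (\<lambda>x. phi1 \<alpha> (x i))" if "i < K" for i
  proof (rule continuous_on_compose2[where g = "phi1 \<alpha>" and t = "{0<..}"])
    show "continuous_on {0<..} (phi1 \<alpha>)"
      using a by (intro continuous_at_imp_continuous_on ballI DERIV_isCont[OF phi1_has_derivative]) auto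
  qed (use simplex_epsD that a in \<open>auto intro: continuous_on_subset[OF continuous_on_product_coordinates]\<close>)
  then show ?thesis unfolding phi_def
    by (intro continuous_intros) (auto intro: continuous_on_subset[OF continuous_on_product_coordinates])
qed

lemma minimizer_exists:
  assumes "1 \<le> K" "real K * \<epsilon> \<le> 1" "0 < \<epsilon>" "0 \<le> \<alpha>" "\<alpha> \<le> 1"
  obtains x where "x \<in> simplex_eps K \<epsilon>"
    "\<forall>y\<in>simplex_eps K \<epsilon>. phi K \<alpha> x - (\<Sum>i<K. w i * x i) \<le> phi K \<alpha> y - (\<Sum>i<K. w i * y i)"
proof -
  have "simplex_eps K \<epsilon> \<noteq> {}" using uniform_in_simplex_eps[of K \<epsilon>] assms by blast
  from continuous_attains_inf[OF compact_simplex_eps this continuous_on_phi_minus_linear[of \<epsilon> \<alpha> K w]]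
  show ?thesis using that assms by blast
qed

lemma dual_proj_exists:
  assumes "1 \<le> K" "real K * \<epsilon> \<le> 1" "0 < \<epsilon>" "0 \<le> \<alpha>" "\<alpha> \<le> 1"
  shows "\<exists>x. dual_proj K \<alpha> \<epsilon> w x"
  by (rule minimizer_exists[OF assms, of w]) (blast intro: dual_proj_if_minimizer assms)

text \<open>Up to terms constant in \<open>x\<close>, the divergence from \<open>z\<close> is
  \<open>phi\<close> minus the linear form with coefficients \<open>psi \<alpha> (z i)\<close>.
  Hence whichever minimizer \<open>proj\<close> chooses satisfies the optimality condition.\<close>

lemma dual_proj_proj:
  assumes z: "z \<in> posorth K" and a: "1 \<le> K" "real K * \<epsilon> \<le> 1" "0 < \<epsilon>" "0 \<le> \<alpha>" "\<alpha> \<le> 1"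
  shows "dual_proj K \<alpha> \<epsilon> (\<lambda>i. psi \<alpha> (z i)) (proj K (phi K \<alpha>) \<epsilon> z)"
proof -
  have zp: "0 < z i" if "i < K" for i using z that by (auto simp: posorth_def)
  have eq: "bregman K (phi K \<alpha>) x z =
      phi K \<alpha> x - (\<Sum>i<K. psi \<alpha> (z i) * x i) - phi K \<alpha> z + (\<Sum>i<K. psi \<alpha> (z i) * z i)" for x
    using zp a by (subst bregman_phi) (auto simp: breg1_def phi_def sum_subtractf right_diff_distrib)
  have "\<exists>x. x \<in> simplex_eps K \<epsilon> \<and>
       (\<forall>y\<in>simplex_eps K \<epsilon>. bregman K (phi K \<alpha>) x z \<le> bregman K (phi K \<alpha>) y z)"
    unfolding eq by (rule minimizer_exists[OF a, of "\<lambda>i. psi \<alpha> (z i)"]) auto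
  then have "proj K (phi K \<alpha>) \<epsilon> z \<in> simplex_eps K \<epsilon> \<and>
       (\<forall>y\<in>simplex_eps K \<epsilon>. bregman K (phi K \<alpha>) (proj K (phi K \<alpha>) \<epsilon> z) z \<le> bregman K (phi K \<alpha>) y z)"
    unfolding proj_def by (rule someI_ex)
  then show ?thesis unfolding eq using a by (intro dual_proj_if_minimizer) auto
qed

text \<open>Each variational inequality is tested at the other solution and the two are added.
  Strong monotonicity bounds the squared distance of the solutions by their inner product with
  \<open>w - v\<close>, and Young's inequality concludes.\<close>

lemma dual_proj_nonexpansive:
  assumes x: "dual_proj K \<alpha> \<epsilon> w x" and y: "dual_proj K \<alpha> \<epsilon> v y" and a: "0 < \<epsilon>" "\<alpha> \<le> 1"
  shows "(\<Sum>i<K. (x i - y i)\<^sup>2) \<le> (\<Sum>i<K. (w i - v i)\<^sup>2)"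
proof -
  have xs: "x \<in> simplex_eps K \<epsilon>" "y \<in> simplex_eps K \<epsilon>" using x y by (auto simp: dual_proj_def)
  have "0 \<le> (\<Sum>i<K. (psi \<alpha> (x i) - w i) * (y i - x i)) + (\<Sum>i<K. (psi \<alpha> (y i) - v i) * (x i - y i))"
    using x y xs by (auto simp: dual_proj_def)
  also have "\<dots> = (\<Sum>i<K. (w i - v i) * (x i - y i) - (psi \<alpha> (x i) - psi \<alpha> (y i)) * (x i - y i))"
    unfolding sum.distrib[symmetric] by (intro sum.cong refl) (simp add: algebra_simps)
  also have "\<dots> \<le> (\<Sum>i<K. (w i - v i)\<^sup>2 / 2 - (x i - y i)\<^sup>2 / 2)"
  proof (intro sum_mono)
    fix i assume "i \<in> {..<K}"
    then have "(x i - y i)\<^sup>2 \<le> (psi \<alpha> (x i) - psi \<alpha> (y i)) * (x i - y i)"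
      using a simplex_epsD[OF xs(1)] simplex_epsD[OF xs(2)] by (intro psi_strongly_monotone) auto
    moreover have "(w i - v i) * (x i - y i) \<le> (w i - v i)\<^sup>2 / 2 + (x i - y i)\<^sup>2 / 2"
      using sum_squares_bound[of "w i - v i" "x i - y i"] by linarith
    ultimately show "(w i - v i) * (x i - y i) - (psi \<alpha> (x i) - psi \<alpha> (y i)) * (x i - y i)
        \<le> (w i - v i)\<^sup>2 / 2 - (x i - y i)\<^sup>2 / 2" by linarith
  qed
  finally show ?thesis by (simp add: sum_subtractf sum_divide_distrib[symmetric])
qed

section \<open>Regret of mirror descent with regularized losses\<close>

text \<open>By the three-point identity, the difference of the two sides is the divergence of
  \<open>x\<close> from \<open>z\<close> plus the variational inequality tested at \<open>u\<close>;
  both are nonnegative.\<close>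

lemma dual_proj_pythagoras:
  assumes x: "dual_proj K \<alpha> \<epsilon> (\<lambda>i. psi \<alpha> (z i)) x" and z: "\<And>i. i < K \<Longrightarrow> 0 < z i"
    and u: "u \<in> simplex_eps K \<epsilon>" and a: "0 < \<epsilon>" "0 \<le> \<alpha>" "\<alpha> \<le> 1"
  shows "(\<Sum>i<K. breg1 \<alpha> (u i) (x i)) \<le> (\<Sum>i<K. breg1 \<alpha> (u i) (z i))"
proof -
  have xs: "x \<in> simplex_eps K \<epsilon>" using x by (simp add: dual_proj_def)
  have "0 \<le> (\<Sum>i<K. (psi \<alpha> (x i) - psi \<alpha> (z i)) * (u i - x i))"
    using x u by (simp add: dual_proj_def)
  also have "\<dots> \<le> (\<Sum>i<K. breg1 \<alpha> (u i) (z i) - breg1 \<alpha> (u i) (x i))"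
  proof (intro sum_mono)
    fix i assume i: "i \<in> {..<K}"
    have "0 \<le> breg1 \<alpha> (x i) (z i)"
      using i z simplex_epsD[OF xs a(1)] a by (intro breg1_nonneg) auto
    then show "(psi \<alpha> (x i) - psi \<alpha> (z i)) * (u i - x i) \<le> breg1 \<alpha> (u i) (z i) - breg1 \<alpha> (u i) (x i)"
      by (simp add: breg1_def algebra_simps)
  qed
  finally show ?thesis by (simp add: sum_subtractf)
qed

text \<open>The three-point identity is applied at the unprojected point \<open>z\<close>. The
  divergence of \<open>x\<close> from \<open>z\<close> becomes the quadratic term, and projecting
  \<open>z\<close> to \<open>x'\<close> only helps.\<close>

lemma mirror_descent_step:
  assumes xs: "x \<in> simplex_eps K \<epsilon>" and u: "u \<in> simplex_eps K \<epsilon>"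
    and z: "\<And>i. i < K \<Longrightarrow> 0 < z i" "\<And>i. i < K \<Longrightarrow> psi \<alpha> (z i) = psi \<alpha> (x i) - c i"
    and c: "\<And>i. i < K \<Longrightarrow> 0 \<le> c i"
    and x': "dual_proj K \<alpha> \<epsilon> (\<lambda>i. psi \<alpha> (z i)) x'"
    and a: "0 < \<epsilon>" "0 \<le> \<alpha>" "\<alpha> \<le> 1"
  shows "(\<Sum>i<K. c i * (x i - u i))
    \<le> (\<Sum>i<K. breg1 \<alpha> (u i) (x i)) - (\<Sum>i<K. breg1 \<alpha> (u i) (x' i)) + (\<Sum>i<K. (c i)\<^sup>2 * x i)"
proof -
  have "(\<Sum>i<K. c i * (x i - u i)) \<le>
      (\<Sum>i<K. breg1 \<alpha> (u i) (x i) - breg1 \<alpha> (u i) (z i) + (c i)\<^sup>2 * x i)"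
  proof (intro sum_mono)
    fix i assume i: "i \<in> {..<K}"
    then have ci: "c i = psi \<alpha> (x i) - psi \<alpha> (z i)" and "0 < z i" "0 \<le> c i" using z c by auto
    moreover have "0 < x i" "x i \<le> 1" using simplex_epsD[OF xs a(1)] i by auto
    \<comment> \<open>Nonnegative losses move every coordinate down, as
      \<open>breg1_dual_step_le\<close> requires.\<close>
    moreover have "z i \<le> x i"
      using psi_strict_mono[of "x i" "z i" \<alpha>] calculation by force
    ultimately have "breg1 \<alpha> (x i) (z i) \<le> (c i)\<^sup>2 * x i"
      using a breg1_dual_step_le[of "z i" "x i" \<alpha>] by auto
    moreover have "c i * (x i - u i) =
        breg1 \<alpha> (u i) (x i) - breg1 \<alpha> (u i) (z i) + breg1 \<alpha> (x i) (z i)"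
      unfolding ci by (simp add: breg1_def algebra_simps)
    ultimately show "c i * (x i - u i) \<le>
        breg1 \<alpha> (u i) (x i) - breg1 \<alpha> (u i) (z i) + (c i)\<^sup>2 * x i" by simp
  qed
  then show ?thesis using dual_proj_pythagoras[OF x' z(1) u a]
    by (simp add: sum.distrib sum_subtractf)
qed

text \<open>\<open>mirror_descent_step\<close> with \<open>c i = \<eta> * l i\<close>. The linear
  term yields the importance-weighted regret of the round minus the cost of the regularizer, the
  quadratic term is at most \<open>\<eta>\<^sup>2 * (3 + 1 / x A)\<close>, and a common factor
  \<open>\<eta>\<close> is left. The first conclusion keeps the induction over rounds going.\<close>

lemma regularized_exp3_step:
  assumes xs: "x \<in> simplex_eps K \<epsilon>" and u: "u \<in> simplex_eps K \<epsilon>"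
    and A: "A < K" and c: "0 \<le> c" "c \<le> 1" and \<eta>: "0 < \<eta>"
    and l: "l = (\<lambda>j. (if j = A then c / x j else 0) + \<epsilon> * pgrad (Reg K \<epsilon>) x j)"
    and x': "x' = proj K (phi K \<alpha>) \<epsilon> (mstep K (phi K \<alpha>) \<eta> l x)"
    and a: "real K * \<epsilon> \<le> 1" "0 < \<epsilon>" "0 \<le> \<alpha>" "\<alpha> \<le> 1"
  shows "mstep K (phi K \<alpha>) \<eta> l x \<in> posorth K"
    and "\<eta> * (c - c * u A / x A - (real K - 1) * \<epsilon> - \<eta> * (3 + 1 / x A))
      \<le> (\<Sum>i<K. breg1 \<alpha> (u i) (x i)) - (\<Sum>i<K. breg1 \<alpha> (u i) (x' i))"
proof -
  define r where "r = (\<lambda>i. 1 - \<epsilon> / x i)"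
  have xp: "\<epsilon> \<le> x i" "0 < x i" "x i \<le> 1" if "i < K" for i
    using simplex_epsD[OF xs a(2) that] by auto
  have up: "0 < u i" if "i < K" for i
    using simplex_epsD[OF u a(2) that] by auto
  have l': "l i = (if i = A then c / x A else 0) + r i" if "i < K" for i
    using that a xp[OF that] unfolding l by (simp add: pgrad_Reg r_def field_simps)
  have r: "0 \<le> r i" "r i \<le> 1" if "i < K" for i
    using xp[OF that] a by (auto simp: r_def field_simps)
  have l0: "0 \<le> l i" if "i < K" for i
    using r[OF that] c xp[OF A] unfolding l'[OF that] by auto
  have xpos: "x \<in> posorth K" using xp xs by (auto simp: posorth_def simplex_eps_def)
  have \<eta>l: "0 \<le> \<eta> * l i" if "i < K" for i using l0[OF that] \<eta> by simp
  show z: "mstep K (phi K \<alpha>) \<eta> l x \<in> posorth K"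
    by (rule mstep_phi(1)[OF xpos \<eta>l a(3,4)])
  have "(\<Sum>i<K. \<eta> * l i * (x i - u i))
    \<le> (\<Sum>i<K. breg1 \<alpha> (u i) (x i)) - (\<Sum>i<K. breg1 \<alpha> (u i) (x' i)) + (\<Sum>i<K. (\<eta> * l i)\<^sup>2 * x i)"
  proof (rule mirror_descent_step[OF xs u])
    show "0 < mstep K (phi K \<alpha>) \<eta> l x i" if "i < K" for i
      using z that by (simp add: posorth_def)
    show "psi \<alpha> (mstep K (phi K \<alpha>) \<eta> l x i) = psi \<alpha> (x i) - \<eta> * l i" if "i < K" for i
      by (rule mstep_phi(2)[OF xpos \<eta>l a(3,4) that])
    show "dual_proj K \<alpha> \<epsilon> (\<lambda>i. psi \<alpha> (mstep K (phi K \<alpha>) \<eta> l x i)) x'"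
      unfolding x' using z a A by (intro dual_proj_proj) auto
  qed (use \<eta>l a in auto)
  moreover have "\<eta> * (c - c * u A / x A - (real K - 1) * \<epsilon>) \<le> (\<Sum>i<K. \<eta> * l i * (x i - u i))"
  proof -
    have "(\<Sum>i<K. l i * (x i - u i)) =
        (\<Sum>i<K. (if i = A then c / x A * (x i - u i) else 0) + r i * (x i - u i))"
      by (intro sum.cong refl) (auto simp: l' algebra_simps)
    also have "\<dots> = c / x A * (x A - u A) + (\<Sum>i<K. r i * (x i - u i))"
      using A by (simp add: sum.distrib sum.delta)
    also have "c / x A * (x A - u A) = c - c * u A / x A"
      using xp[OF A] by (simp add: field_simps)
    finally have 1: "(\<Sum>i<K. l i * (x i - u i)) = c - c * u A / x A + (\<Sum>i<K. r i * (x i - u i))" .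
    \<comment> \<open>Because \<open>u i / x i\<close> is at least \<open>u i\<close>. Both points
      have total mass 1, so the left side sums to
      \<open>- (real K - 1) * \<epsilon>\<close>.\<close>
    have "(\<Sum>i<K. x i - u i - \<epsilon> + \<epsilon> * u i) \<le> (\<Sum>i<K. r i * (x i - u i))"
    proof (intro sum_mono)
      fix i assume "i \<in> {..<K}"
      then have i: "0 < x i" "x i \<le> 1" "0 < u i" using xp up by auto
      have "r i * (x i - u i) = x i - u i - \<epsilon> + \<epsilon> * (u i / x i)"
        using i by (simp add: r_def field_simps)
      moreover have "u i \<le> u i / x i" using i by (simp add: field_simps)
      then have "\<epsilon> * u i \<le> \<epsilon> * (u i / x i)" using a by (intro mult_left_mono) auto
      ultimately show "x i - u i - \<epsilon> + \<epsilon> * u i \<le> r i * (x i - u i)" by simp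
    qed
    then have "- ((real K - 1) * \<epsilon>) \<le> (\<Sum>i<K. r i * (x i - u i))"
      using simplex_eps_sum[OF xs] simplex_eps_sum[OF u]
      by (simp add: sum.distrib sum_subtractf sum_distrib_left[symmetric] algebra_simps)
    then have "c - c * u A / x A - (real K - 1) * \<epsilon> \<le> (\<Sum>i<K. l i * (x i - u i))"
      unfolding 1 by simp
    then have "\<eta> * (c - c * u A / x A - (real K - 1) * \<epsilon>) \<le> \<eta> * (\<Sum>i<K. l i * (x i - u i))"
      using \<eta> by (intro mult_left_mono) auto
    then show ?thesis by (simp add: sum_distrib_left mult.assoc)
  qed
  moreover have "(\<Sum>i<K. (\<eta> * l i)\<^sup>2 * x i) \<le> \<eta>\<^sup>2 * (3 + 1 / x A)"
  proof -
    \<comment> \<open>Only the played arm contributes an importance weight and a cross term. The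
      constant 3 is 2 from the cross term plus 1 from the squares of \<open>r\<close>, averaged
      under \<open>x\<close>.\<close>
    have "(\<Sum>i<K. (l i)\<^sup>2 * x i) =
        (\<Sum>i<K. (if i = A then (c / x A)\<^sup>2 * x A + 2 * (c / x A) * r A * x A else 0) + (r i)\<^sup>2 * x i)"
      by (intro sum.cong refl) (auto simp: l' power2_eq_square algebra_simps)
    also have "\<dots> = c\<^sup>2 / x A + 2 * c * r A + (\<Sum>i<K. (r i)\<^sup>2 * x i)"
      using A xp[OF A] by (simp add: sum.distrib sum.delta power2_eq_square)
    also have "\<dots> \<le> 1 / x A + 2 + (\<Sum>i<K. x i)"
    proof (intro add_mono sum_mono)
      show "c\<^sup>2 / x A \<le> 1 / x A" using c xp[OF A] by (intro divide_right_mono) (auto simp: power_le_one)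
      have "c * r A \<le> 1 * 1" using c r[OF A] by (intro mult_mono) auto
      then show "2 * c * r A \<le> 2" by simp
      show "(r i)\<^sup>2 * x i \<le> x i" if "i \<in> {..<K}" for i
        using r[of i] xp[of i] that by (intro mult_left_le_one_le) (auto simp: power_le_one)
    qed
    finally have "(\<Sum>i<K. (l i)\<^sup>2 * x i) \<le> 3 + 1 / x A" using simplex_eps_sum[OF xs] by simp
    then have "\<eta>\<^sup>2 * (\<Sum>i<K. (l i)\<^sup>2 * x i) \<le> \<eta>\<^sup>2 * (3 + 1 / x A)" by (intro mult_left_mono) auto
    then show ?thesis by (simp add: sum_distrib_left power_mult_distrib mult.assoc)
  qed
  ultimately show "\<eta> * (c - c * u A / x A - (real K - 1) * \<epsilon> - \<eta> * (3 + 1 / x A))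
      \<le> (\<Sum>i<K. breg1 \<alpha> (u i) (x i)) - (\<Sum>i<K. breg1 \<alpha> (u i) (x' i))"
    by (simp add: power2_eq_square right_diff_distrib mult.assoc)
qed

section \<open>Divergence from the uniform distribution\<close>

text \<open>At the uniform point all coordinates of the gradient agree, so the linear term sees only
  the difference of the total masses, which is 0.\<close>

lemma sum_breg1_uniform:
  assumes "(\<Sum>i<K. u i) = 1" "1 \<le> K"
  shows "(\<Sum>i<K. breg1 \<alpha> (u i) (1 / real K)) = (\<Sum>i<K. phi1 \<alpha> (u i) - phi1 \<alpha> (1 / real K))"
proof -
  have "(\<Sum>i<K. u i - 1 / real K) = 0" using assms by (simp add: sum_subtractf)
  then have "(\<Sum>i<K. psi \<alpha> (1 / real K) * (u i - 1 / real K)) = 0"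
    by (simp add: sum_distrib_left[symmetric])
  then show ?thesis unfolding breg1_def by (subst sum_subtractf) simp
qed

text \<open>Each coordinate is at worst \<open>\<epsilon>\<close>, and passing from
  \<open>1 / real K\<close> down to \<open>\<epsilon>\<close> costs the logarithm of their ratio.
  The factor \<open>1 / (1 - \<alpha>)\<close> restricts its use to \<open>\<alpha>\<close> away
  from 1.\<close>

lemma breg1_uniform_le_ln_eps:
  assumes u: "u \<in> simplex_eps K \<epsilon>" and K: "1 \<le> K" "real K * \<epsilon> \<le> 1" and a: "0 < \<epsilon>" "0 \<le> \<alpha>" "\<alpha> < 1"
  shows "(\<Sum>i<K. breg1 \<alpha> (u i) (1 / real K)) \<le> real K * (- ln (real K * \<epsilon>)) / (1 - \<alpha>)"
proof -
  \<comment> \<open>\<open>h\<close> differs from \<open>phi1 \<alpha>\<close> by a linear term, which is invisible on the simplex; it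
    decreases on \<open>(0, 1]\<close>, but more slowly than \<open>- ln s / (1 - \<alpha>)\<close>.\<close>
  define h where "h = (\<lambda>s. phi1 \<alpha> s - s / (1 - \<alpha>))"
  have dh: "(h has_real_derivative - (s powr (\<alpha> - 1)) / (1 - \<alpha>)) (at s)" if "0 < s" for s
  proof -
    have "(h has_real_derivative psi \<alpha> s - 1 / (1 - \<alpha>)) (at s)"
      unfolding h_def using a that by (auto intro!: derivative_eq_intros phi1_has_derivative)
    moreover have "psi \<alpha> s - 1 / (1 - \<alpha>) = - (s powr (\<alpha> - 1)) / (1 - \<alpha>)"
      using a by (simp add: psi_def diff_divide_distrib)
    ultimately show ?thesis by simp
  qed
  have h_anti: "h t \<le> h s" if "0 < s" "s \<le> t" for s t
  proof (rule DERIV_nonpos_imp_nonincreasing[OF that(2)])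
    fix r assume "s \<le> r" "r \<le> t"
    then show "\<exists>y. (h has_real_derivative y) (at r) \<and> y \<le> 0"
      using dh[of r] that a by (intro exI[of _ "- (r powr (\<alpha> - 1)) / (1 - \<alpha>)"]) auto
  qed
  have g_mono: "h s + ln s / (1 - \<alpha>) \<le> h t + ln t / (1 - \<alpha>)" if "0 < s" "s \<le> t" "t \<le> 1" for s t
  proof (rule DERIV_nonneg_imp_nondecreasing[OF that(2)])
    fix r assume r: "s \<le> r" "r \<le> t"
    have "((\<lambda>s. h s + ln s / (1 - \<alpha>)) has_real_derivative
        - (r powr (\<alpha> - 1)) / (1 - \<alpha>) + (1 / r) / (1 - \<alpha>)) (at r)"
      using r that a by (auto intro!: derivative_eq_intros dh)
    moreover have "r powr (\<alpha> - 1) \<le> r powr (-1)"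
      using r that a by (intro powr_mono') auto
    then have "(r powr (\<alpha> - 1)) / (1 - \<alpha>) \<le> (1 / r) / (1 - \<alpha>)"
      using a r that by (intro divide_right_mono) (auto simp: powr_minus_divide)
    then have "0 \<le> - (r powr (\<alpha> - 1)) / (1 - \<alpha>) + (1 / r) / (1 - \<alpha>)"
      by simp
    ultimately show "\<exists>y. ((\<lambda>s. h s + ln s / (1 - \<alpha>)) has_real_derivative y) (at r) \<and> 0 \<le> y"
      by blast
  qed
  have eK: "\<epsilon> \<le> 1 / real K" using K by (simp add: field_simps)
  have bound: "phi1 \<alpha> (u i) - phi1 \<alpha> (1 / real K)
      \<le> (u i - 1 / real K) / (1 - \<alpha>) + - ln (real K * \<epsilon>) / (1 - \<alpha>)" if "i < K" for i
  proof -
    have "h (u i) \<le> h \<epsilon>" using simplex_epsD[OF u a(1) that] a by (intro h_anti) auto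
    moreover have "h \<epsilon> + ln \<epsilon> / (1 - \<alpha>) \<le> h (1 / real K) + ln (1 / real K) / (1 - \<alpha>)"
      using eK a K by (intro g_mono) auto
    moreover have "ln (1 / real K) / (1 - \<alpha>) - ln \<epsilon> / (1 - \<alpha>) = - ln (real K * \<epsilon>) / (1 - \<alpha>)"
      using a K by (simp add: ln_mult ln_div diff_divide_distrib)
    ultimately have "h (u i) - h (1 / real K) \<le> - ln (real K * \<epsilon>) / (1 - \<alpha>)" by linarith
    then show ?thesis unfolding h_def by (simp add: diff_divide_distrib)
  qed
  have "(\<Sum>i<K. breg1 \<alpha> (u i) (1 / real K)) \<le>
      (\<Sum>i<K. (u i - 1 / real K) / (1 - \<alpha>) + - ln (real K * \<epsilon>) / (1 - \<alpha>))"
    unfolding sum_breg1_uniform[OF simplex_eps_sum[OF u] K(1)]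
    by (intro sum_mono bound) auto
  also have "\<dots> = real K * (- ln (real K * \<epsilon>)) / (1 - \<alpha>)"
    using simplex_eps_sum[OF u] K
    by (simp add: sum.distrib sum_divide_distrib[symmetric] sum_subtractf)
  finally show ?thesis .
qed

text \<open>A maximal-entropy bound, free of \<open>\<epsilon>\<close>. For
  \<open>\<alpha> < 1\<close> the sum of the powers \<open>u i powr \<alpha>\<close> is at least 1,
  while the uniform point gives \<open>real K powr (1 - \<alpha>)\<close>. The factor
  \<open>1 / \<alpha>\<close> is where the threshold \<open>1/3\<close> and the constant 3 come
  from.\<close>

lemma breg1_uniform_le_ln_dim:
  assumes u: "u \<in> simplex_eps K \<epsilon>" and K: "1 \<le> K" and a: "0 < \<epsilon>" "1/3 \<le> \<alpha>" "\<alpha> \<le> 1"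
  shows "(\<Sum>i<K. breg1 \<alpha> (u i) (1 / real K)) \<le> 3 * real K * ln (real K)"
proof -
  have up: "0 < u i" "u i \<le> 1" if "i < K" for i using simplex_epsD[OF u a(1) that] by auto
  note eq = sum_breg1_uniform[OF simplex_eps_sum[OF u] K]
  show ?thesis
  proof (cases "\<alpha> = 1")
    case True
    have "(\<Sum>i<K. breg1 \<alpha> (u i) (1 / real K)) =
        (\<Sum>i<K. u i * ln (u i) - (u i - 1 / real K) - ln (1 / real K) / real K)"
      unfolding eq using True by (simp add: phi1_def algebra_simps)
    also have "\<dots> = (\<Sum>i<K. u i * ln (u i)) + ln (real K)"
      using K simplex_eps_sum[OF u] by (simp add: sum_subtractf sum.distrib ln_div)
    also have "(\<Sum>i<K. u i * ln (u i)) \<le> 0"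
      using up by (intro sum_nonpos mult_nonneg_nonpos) (auto intro: less_imp_le)
    also have "0 + ln (real K) \<le> 3 * real K * ln (real K)"
      using K mult_right_mono[of 1 "3 * real K" "ln (real K)"] by simp
    finally show ?thesis by simp
  next
    case False
    then have a1: "0 < \<alpha>" "\<alpha> < 1" using a by auto
    have "(\<Sum>i<K. breg1 \<alpha> (u i) (1 / real K)) =
        (\<Sum>i<K. ((1 / real K) powr \<alpha> - u i powr \<alpha> + \<alpha> * (u i - 1 / real K)) / (\<alpha> * (1 - \<alpha>)))"
      unfolding eq using a1 by (intro sum.cong refl) (simp add: phi1_def diff_divide_distrib add_divide_distrib right_diff_distrib)
    also have "\<dots> = (real K * (1 / real K) powr \<alpha> - (\<Sum>i<K. u i powr \<alpha>)) / (\<alpha> * (1 - \<alpha>))"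
      using K simplex_eps_sum[OF u]
      by (simp add: sum_divide_distrib[symmetric] sum.distrib sum_subtractf sum_distrib_left[symmetric])
    also have "\<dots> \<le> (real K powr (1 - \<alpha>) - 1) / (\<alpha> * (1 - \<alpha>))"
    proof (intro divide_right_mono diff_mono)
      show "real K * (1 / real K) powr \<alpha> \<le> real K powr (1 - \<alpha>)"
        using K by (simp add: powr_diff powr_divide)
      have "(\<Sum>i<K. u i powr 1) \<le> (\<Sum>i<K. u i powr \<alpha>)"
        using up a1 by (intro sum_mono powr_mono') (auto intro: less_imp_le)
      then show "1 \<le> (\<Sum>i<K. u i powr \<alpha>)"
        using simplex_eps_sum[OF u] up by (simp add: less_imp_le)
    qed (use a1 in auto)
    also have "\<dots> = ((real K powr (1 - \<alpha>) - 1) / (1 - \<alpha>)) / \<alpha>" by simp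
    also have "\<dots> \<le> (real K * ln (real K)) / \<alpha>"
    proof (intro divide_right_mono)
      \<comment> \<open>\<open>exp y - 1 \<le> y * exp y\<close> with \<open>y = (1 - \<alpha>) * ln K\<close>\<close>
      define y where "y = (1 - \<alpha>) * ln (real K)"
      have ey: "real K powr (1 - \<alpha>) = exp y" using K by (simp add: powr_def y_def)
      have "1 - y \<le> exp (- y)" using exp_ge_add_one_self[of "- y"] by simp
      then have "(1 - y) * exp y \<le> exp (- y) * exp y" by (intro mult_right_mono) auto
      then have "exp y - 1 \<le> y * exp y" by (simp add: exp_minus algebra_simps)
      then have "(real K powr (1 - \<alpha>) - 1) / (1 - \<alpha>) \<le> ln (real K) * real K powr (1 - \<alpha>)"
        unfolding ey using a1 by (simp add: y_def field_simps)
      also have "\<dots> \<le> ln (real K) * real K powr 1"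
        using K a1 by (intro mult_left_mono powr_mono) auto
      finally show "(real K powr (1 - \<alpha>) - 1) / (1 - \<alpha>) \<le> real K * ln (real K)"
        using K by (simp add: mult.commute)
    qed (use a1 in auto)
    also have "\<dots> \<le> 3 * (real K * ln (real K))"
      using K a mult_right_mono[of 1 "3 * \<alpha>" "real K * ln (real K)"] by (simp add: field_simps)
    finally show ?thesis by simp
  qed
qed

section \<open>Measurability, the comparator and the sampling of arms\<close>

text \<open>An arbitrary selection \<open>Q\<close> of solutions is nonexpansive, hence continuous
  in the gradient. As solutions are unique in the coordinates below \<open>K\<close>,
  \<open>x\<close> is \<open>Q\<close> composed with a measurable map.\<close>

lemma measurable_dual_proj:
  assumes w: "\<And>i. i < K \<Longrightarrow> (\<lambda>\<omega>. w \<omega> i) \<in> borel_measurable M"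
    and x: "\<And>\<omega>. \<omega> \<in> space M \<Longrightarrow> dual_proj K \<alpha> \<epsilon> (w \<omega>) (x \<omega>)"
    and i: "i < K"
    and a: "real K * \<epsilon> \<le> 1" "0 < \<epsilon>" "0 \<le> \<alpha>" "\<alpha> \<le> 1"
  shows "(\<lambda>\<omega>. x \<omega> i) \<in> borel_measurable M"
proof -
  obtain Q where Q: "dual_proj K \<alpha> \<epsilon> w (Q w)" for w
    using dual_proj_exists[of K \<epsilon> \<alpha>] i a by (metis leI less_one not_less_zero)
  have le: "\<bar>y i - y' i\<bar> \<le> sqrt (\<Sum>j<K. (v j - v' j)\<^sup>2)"
    if "dual_proj K \<alpha> \<epsilon> v y" "dual_proj K \<alpha> \<epsilon> v' y'" for v v' y y'
  proof -
    have "(y i - y' i)\<^sup>2 \<le> (\<Sum>j<K. (y j - y' j)\<^sup>2)"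
      using i member_le_sum[of i "{..<K}" "\<lambda>j. (y j - y' j)\<^sup>2"] by auto
    also have "\<dots> \<le> (\<Sum>j<K. (v j - v' j)\<^sup>2)" by (rule dual_proj_nonexpansive[OF that a(2,4)])
    finally show ?thesis using real_le_rsqrt by (metis power2_abs)
  qed
  have "continuous_on UNIV (\<lambda>w. Q w i)"
    unfolding continuous_on_def
  proof
    fix v :: "nat \<Rightarrow> real"
    have "continuous_on UNIV (\<lambda>w :: nat \<Rightarrow> real. sqrt (\<Sum>j<K. (w j - v j)\<^sup>2))"
      by (intro continuous_intros continuous_on_product_coordinates)
    then have "((\<lambda>w. sqrt (\<Sum>j<K. (w j - v j)\<^sup>2)) \<longlongrightarrow> sqrt (\<Sum>j<K. (v j - v j)\<^sup>2)) (at v)"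
      by (simp only: continuous_on_def UNIV_I ball_UNIV)
    then have "((\<lambda>w. sqrt (\<Sum>j<K. (w j - v j)\<^sup>2)) \<longlongrightarrow> 0) (at v)" by simp
    then have "((\<lambda>w. Q w i - Q v i) \<longlongrightarrow> 0) (at v)"
      by (rule Lim_null_comparison[rotated]) (auto intro!: always_eventually le Q)
    then show "((\<lambda>w. Q w i) \<longlongrightarrow> Q v i) (at v)" by (simp add: LIM_zero_iff)
  qed
  then have [measurable]: "(\<lambda>w. Q w i) \<in> borel_measurable borel"
    by (rule borel_measurable_continuous_onI)
  \<comment> \<open>The coordinates of \<open>w\<close> from \<open>K\<close> on may fail to be
    measurable; \<open>dual_proj\<close> does not see them, so they are reset to 0.\<close>
  define w' where "w' = (\<lambda>\<omega> j. if j < K then w \<omega> j else 0)"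
  have [measurable]: "w' \<in> borel_measurable M"
  proof (rule measurable_coordinatewise_then_product)
    show "(\<lambda>\<omega>. w' \<omega> j) \<in> borel_measurable M" for j
      using w[of j] by (cases "j < K") (auto simp: w'_def)
  qed
  have "(\<lambda>\<omega>. Q (w' \<omega>) i) \<in> borel_measurable M" by measurable
  moreover have "x \<omega> i = Q (w' \<omega>) i" if "\<omega> \<in> space M" for \<omega>
    using le[OF x[OF that] Q[of "w' \<omega>"]] by (simp add: w'_def)
  ultimately show ?thesis by (simp cong: measurable_cong)
qed

text \<open>The vertex of arm \<open>a\<close> pulled into the truncated simplex:
  \<open>1 - real K * \<epsilon>\<close> times the vertex plus \<open>\<epsilon>\<close> in every
  coordinate. The projection inequality compares only with points of that set.\<close>

definition mixed_arm :: "nat \<Rightarrow> real \<Rightarrow> nat \<Rightarrow> nat \<Rightarrow> real" where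
  "mixed_arm K \<epsilon> a = (\<lambda>i. if i < K then (if i = a then 1 - (real K - 1) * \<epsilon> else \<epsilon>) else 0)"

lemma mixed_arm_in_simplex_eps:
  assumes "a < K" "real K * \<epsilon> \<le> 1"
  shows "mixed_arm K \<epsilon> a \<in> simplex_eps K \<epsilon>"
proof -
  have "(\<Sum>j<K. mixed_arm K \<epsilon> a j) = (\<Sum>j<K. (if j = a then 1 - real K * \<epsilon> else 0) + \<epsilon>)"
    by (intro sum.cong) (auto simp: mixed_arm_def algebra_simps)
  also have "\<dots> = 1" using assms by (simp add: sum.distrib sum.delta)
  finally show ?thesis using assms by (auto simp: simplex_eps_def mixed_arm_def algebra_simps)
qed

lemma sample_less: "1 \<le> K \<Longrightarrow> sample K x u < K"
  using Least_le[of "\<lambda>j. j = K - 1 \<or> u < (\<Sum>i\<le>j. x i)" "K - 1"] unfolding sample_def by simp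

text \<open>Confines the seeds that select arm \<open>j\<close> to an interval of length
  \<open>x j\<close>. The default arm \<open>K - 1\<close> is covered since the partial sums reach 1
  there.\<close>

lemma sample_bounds:
  assumes s: "sample K x u = j" and x: "(\<Sum>i<K. x i) = 1" and K: "1 \<le> K" and u: "0 \<le> u" "u \<le> 1"
  shows "(\<Sum>i<j. x i) \<le> u" "u \<le> (\<Sum>i<j. x i) + x j"
proof -
  let ?P = "\<lambda>j. j = K - 1 \<or> u < (\<Sum>i\<le>j. x i)"
  show "(\<Sum>i<j. x i) \<le> u"
  proof (cases j)
    case (Suc j')
    then have "\<not> ?P j'" using not_less_Least[of j' ?P] s unfolding sample_def by simp
    then show ?thesis using Suc by (simp add: lessThan_Suc_atMost)
  qed (use u in simp)
  have "?P j" using LeastI[of ?P "K - 1"] s unfolding sample_def by simp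
  then show "u \<le> (\<Sum>i<j. x i) + x j"
  proof
    assume "j = K - 1"
    then have "(\<Sum>i<j. x i) + x j = (\<Sum>i<K. x i)"
      using K by (metis Suc_diff_1 less_le_trans zero_less_one sum.lessThan_Suc)
    then show ?thesis using x u by simp
  next
    assume "u < (\<Sum>i\<le>j. x i)"
    then show ?thesis by (simp flip: lessThan_Suc_atMost)
  qed
qed

lemma measurable_sample:
  assumes [measurable]: "u \<in> borel_measurable M" "\<And>i. (\<lambda>\<omega>. x \<omega> i) \<in> borel_measurable M"
  shows "(\<lambda>\<omega>. sample K (x \<omega>) (u \<omega>)) \<in> measurable M (count_space UNIV)"
  unfolding sample_def by measurable

text \<open>Confining the seeds of each arm to an interval bounds its probability from above. This
  one-sided form suffices because only nonnegative costs are averaged, and it makes the endpoints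
  harmless.\<close>

lemma nn_integral_sample_le:
  fixes F :: "nat \<Rightarrow> ennreal"
  assumes x: "(\<Sum>i<K. x i) = 1" "\<And>i. i < K \<Longrightarrow> 0 \<le> x i" and K: "1 \<le> K"
  shows "(\<integral>\<^sup>+u. F (sample K x u) \<partial>uniform_measure lborel {0..1::real}) \<le> (\<Sum>j<K. ennreal (x j) * F j)"
proof -
  let ?U = "uniform_measure lborel {0..1::real}"
  have S[measurable]: "sample K x \<in> measurable borel (count_space UNIV)"
    using measurable_sample[of "\<lambda>u. u" borel "\<lambda>_. x" K] by simp
  have set[measurable]: "{u. sample K x u = j} \<in> sets borel" for j
    using measurable_sets[OF S, of "{j}"] by (simp add: vimage_def)
  have "(\<integral>\<^sup>+u. F (sample K x u) \<partial>?U) = (\<integral>\<^sup>+u. (\<Sum>j<K. F j * indicator {u. sample K x u = j} u) \<partial>?U)"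
  proof (rule nn_integral_cong)
    fix u
    have "(\<Sum>j<K. F j * indicator {u. sample K x u = j} u) = (\<Sum>j<K. if j = sample K x u then F j else 0)"
      by (intro sum.cong) (auto simp: indicator_def)
    then show "F (sample K x u) = (\<Sum>j<K. F j * indicator {u. sample K x u = j} u)"
      using sample_less[OF K, of x u] by simp
  qed
  also have "\<dots> = (\<Sum>j<K. F j * emeasure ?U {u. sample K x u = j})"
    by (subst nn_integral_sum) (auto simp: nn_integral_cmult_indicator set)
  also have "\<dots> \<le> (\<Sum>j<K. F j * ennreal (x j))"
  proof (intro sum_mono mult_left_mono)
    fix j assume j: "j \<in> {..<K}"
    have "emeasure ?U {u. sample K x u = j} = emeasure lborel ({0..1} \<inter> {u. sample K x u = j})"
      by (subst emeasure_uniform_measure) (auto simp: set divide_ennreal_def)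
    also have "\<dots> \<le> emeasure lborel {(\<Sum>i<j. x i)..(\<Sum>i<j. x i) + x j}"
      using sample_bounds[OF _ x(1) K] by (intro emeasure_mono) auto
    also have "\<dots> = ennreal (x j)" using x(2)[of j] j by simp
    finally show "emeasure ?U {u. sample K x u = j} \<le> ennreal (x j)" .
  qed simp
  finally show ?thesis by (simp add: mult.commute)
qed

section \<open>The corrupted bandit\<close>

lemma borel_measurable_psi [measurable]: "psi \<alpha> \<in> borel_measurable borel"
  unfolding psi_def[abs_def] by measurable

section \<open>Resampling the learner's seed\<close>

text \<open>On the right the old middle coordinate no longer occurs and integrates out with mass 1;
  Tonelli's theorem then exchanges the fresh one with the third.\<close>

lemma nn_integral_resample_middle:
  assumes "prob_space D" "prob_space U" "prob_space V"
    and [measurable]: "g \<in> borel_measurable (D \<Otimes>\<^sub>M (U \<Otimes>\<^sub>M V))"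
  shows "(\<integral>\<^sup>+y. g y \<partial>(D \<Otimes>\<^sub>M (U \<Otimes>\<^sub>M V)))
    = (\<integral>\<^sup>+y. (\<integral>\<^sup>+u. g (fst y, u, snd (snd y)) \<partial>U) \<partial>(D \<Otimes>\<^sub>M (U \<Otimes>\<^sub>M V)))"
proof -
  interpret D: prob_space D by fact
  interpret U: prob_space U by fact
  interpret V: prob_space V by fact
  interpret UV: pair_prob_space U V ..
  have iter: "(\<integral>\<^sup>+y. h y \<partial>(D \<Otimes>\<^sub>M (U \<Otimes>\<^sub>M V))) = (\<integral>\<^sup>+l. \<integral>\<^sup>+u. \<integral>\<^sup>+v. h (l, u, v) \<partial>V \<partial>U \<partial>D)"
    if h: "h \<in> borel_measurable (D \<Otimes>\<^sub>M (U \<Otimes>\<^sub>M V))" for h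
    unfolding UV.nn_integral_fst[OF h, symmetric]
  proof (rule nn_integral_cong)
    fix l assume "l \<in> space D"
    then have "(\<lambda>p. h (l, p)) \<in> borel_measurable (U \<Otimes>\<^sub>M V)"
      by (intro measurable_compose[OF measurable_Pair1' h])
    then show "(\<integral>\<^sup>+p. h (l, p) \<partial>(U \<Otimes>\<^sub>M V)) = (\<integral>\<^sup>+u. \<integral>\<^sup>+v. h (l, u, v) \<partial>V \<partial>U)"
      by (rule V.nn_integral_fst[symmetric])
  qed
  have "(\<integral>\<^sup>+y. (\<integral>\<^sup>+u. g (fst y, u, snd (snd y)) \<partial>U) \<partial>(D \<Otimes>\<^sub>M (U \<Otimes>\<^sub>M V)))
      = (\<integral>\<^sup>+l. \<integral>\<^sup>+u'. \<integral>\<^sup>+v. \<integral>\<^sup>+u. g (l, u, v) \<partial>U \<partial>V \<partial>U \<partial>D)"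
    by (subst iter) simp_all
  also have "\<dots> = (\<integral>\<^sup>+l. \<integral>\<^sup>+v. \<integral>\<^sup>+u. g (l, u, v) \<partial>U \<partial>V \<partial>D)"
    by (simp add: U.emeasure_space_1)
  also have "\<dots> = (\<integral>\<^sup>+l. \<integral>\<^sup>+u. \<integral>\<^sup>+v. g (l, u, v) \<partial>V \<partial>U \<partial>D)"
    by (intro nn_integral_cong UV.Fubini') measurable
  also have "\<dots> = (\<integral>\<^sup>+y. g y \<partial>(D \<Otimes>\<^sub>M (U \<Otimes>\<^sub>M V)))"
    by (rule iter[symmetric]) measurable
  finally show ?thesis by simp
qed

text \<open>Averaging over \<open>u\<close> is the conditional expectation given all randomness
  except the learner's seed of round \<open>t\<close>.\<close>

definition reseed :: "nat \<Rightarrow> 'b \<Rightarrow> (nat \<Rightarrow> 'a \<times> 'b \<times> 'c) \<Rightarrow> nat \<Rightarrow> 'a \<times> 'b \<times> 'c" where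
  "reseed t u w = w(t := (fst (w t), u, snd (snd (w t))))"

text \<open>The tower rule for that conditional expectation: coordinate \<open>t\<close> is split
  off the product, and the middle factor of this round is resampled.\<close>

lemma nn_integral_PiM_resample:
  fixes t :: nat
  assumes p: "prob_space D" "prob_space U" "prob_space V" and t: "t < T"
    and f[measurable]: "f \<in> borel_measurable (Pi\<^sub>M {..<T} (\<lambda>_. D \<Otimes>\<^sub>M (U \<Otimes>\<^sub>M V)))"
  shows "(\<integral>\<^sup>+\<omega>. f \<omega> \<partial>(Pi\<^sub>M {..<T} (\<lambda>_. D \<Otimes>\<^sub>M (U \<Otimes>\<^sub>M V))))
    = (\<integral>\<^sup>+\<omega>. (\<integral>\<^sup>+u. f (reseed t u \<omega>) \<partial>U)
         \<partial>(Pi\<^sub>M {..<T} (\<lambda>_. D \<Otimes>\<^sub>M (U \<Otimes>\<^sub>M V))))"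
proof -
  let ?R = "D \<Otimes>\<^sub>M (U \<Otimes>\<^sub>M V)"
  let ?J = "{..<T} - {t}"
  let ?\<Omega> = "Pi\<^sub>M {..<T} (\<lambda>_. ?R)"
  let ?h = "\<lambda>\<omega>. \<integral>\<^sup>+u. f (reseed t u \<omega>) \<partial>U"
  interpret U: prob_space U by fact
  interpret R: prob_space ?R using p by (intro prob_space_pair)
  interpret P: product_sigma_finite "\<lambda>_::nat. ?R" by standard
  have T: "{..<T} = insert t ?J" using t by auto
  have comp[measurable]: "(\<lambda>\<omega>. \<omega> t) \<in> measurable ?\<Omega> ?R" using t by (intro measurable_component_singleton) auto
  have upd[measurable]: "(\<lambda>p. (fst p)(t := (fst (fst p t), snd p, snd (snd (fst p t))))) \<in> measurable (?\<Omega> \<Otimes>\<^sub>M U) ?\<Omega>"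
    using t by (intro measurable_fun_upd[where J = "{..<T}"]) auto
  have h[measurable]: "?h \<in> borel_measurable ?\<Omega>"
  proof (rule U.borel_measurable_nn_integral)
    show "(\<lambda>(\<omega>, u). f (reseed t u \<omega>)) \<in> borel_measurable (?\<Omega> \<Otimes>\<^sub>M U)"
      using measurable_compose[OF upd f] by (simp add: case_prod_unfold reseed_def)
  qed
  have ins: "(\<integral>\<^sup>+\<omega>. g \<omega> \<partial>?\<Omega>) = (\<integral>\<^sup>+x. (\<integral>\<^sup>+y. g (x(t := y)) \<partial>?R) \<partial>(Pi\<^sub>M ?J (\<lambda>_. ?R)))"
    if "g \<in> borel_measurable ?\<Omega>" for g
    using P.product_nn_integral_insert[of ?J t g] that T by auto
  have "(\<integral>\<^sup>+\<omega>. f \<omega> \<partial>?\<Omega>) = (\<integral>\<^sup>+x. (\<integral>\<^sup>+y. f (x(t := y)) \<partial>?R) \<partial>(Pi\<^sub>M ?J (\<lambda>_. ?R)))"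
    by (rule ins[OF f])
  also have "\<dots> = (\<integral>\<^sup>+x. (\<integral>\<^sup>+y. ?h (x(t := y)) \<partial>?R) \<partial>(Pi\<^sub>M ?J (\<lambda>_. ?R)))"
  proof (rule nn_integral_cong)
    fix x assume x: "x \<in> space (Pi\<^sub>M ?J (\<lambda>_. ?R))"
    have "(\<lambda>y. x(t := y)) \<in> measurable ?R ?\<Omega>"
      using measurable_component_update[OF x, of t] T by auto
    then have "(\<lambda>y. f (x(t := y))) \<in> borel_measurable ?R"
      using f by (rule measurable_compose)
    from nn_integral_resample_middle[OF p this]
    show "(\<integral>\<^sup>+y. f (x(t := y)) \<partial>?R) = (\<integral>\<^sup>+y. ?h (x(t := y)) \<partial>?R)" by (simp add: reseed_def)
  qed
  also have "\<dots> = (\<integral>\<^sup>+\<omega>. ?h \<omega> \<partial>?\<Omega>)" by (rule ins[OF h, symmetric])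
  finally show ?thesis .
qed

section \<open>The probability space and the iterates of the algorithm\<close>

abbreviation (input) unif01 :: "real measure" where
  "unif01 \<equiv> uniform_measure lborel {0..1}"

lemma prob_space_unif01: "prob_space unif01"
  by (intro prob_space_uniform_measure) auto

abbreviation (input) round_measure :: "(nat \<Rightarrow> real) measure \<Rightarrow> rnd measure" where
  "round_measure D \<equiv> D \<Otimes>\<^sub>M (unif01 \<Otimes>\<^sub>M unif01)"

text \<open>In \<open>adv_causal\<close> the adversary sees the past, the current loss and its own
  seed, but not the learner's current seed. This is what permits resampling that seed without
  changing the corrupted loss.\<close>

locale corrupted_bandit =
  fixes K T :: nat and \<alpha> \<eta> \<epsilon> :: real
    and D :: "(nat \<Rightarrow> real) measure"
    and adv :: "nat \<Rightarrow> (nat \<Rightarrow> rnd) \<Rightarrow> nat \<Rightarrow> real"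
    and \<Omega> :: "(nat \<Rightarrow> rnd) measure"
  defines \<Omega>_def: "\<Omega> \<equiv> Pi\<^sub>M {..<T} (\<lambda>_. round_measure D)"
  assumes K: "1 \<le> K"
    and D_prob: "prob_space D"
    and D_sets: "sets D = sets (Pi\<^sub>M {..<K} (\<lambda>_. borel))"
    and D_range: "AE l in D. \<forall>j<K. 0 \<le> l j \<and> l j \<le> 1"
    and adv_causal: "\<And>t \<omega> \<omega>'. t < T \<Longrightarrow> (\<forall>s<t. \<omega> s = \<omega>' s) \<Longrightarrow> fst (\<omega> t) = fst (\<omega>' t)
                       \<Longrightarrow> snd (snd (\<omega> t)) = snd (snd (\<omega>' t)) \<Longrightarrow> adv t \<omega> = adv t \<omega>'"
    and adv_range: "\<And>t \<omega> j. t < T \<Longrightarrow> \<omega> \<in> space \<Omega> \<Longrightarrow> j < K \<Longrightarrow> 0 \<le> adv t \<omega> j \<and> adv t \<omega> j \<le> 1"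
    and adv_meas: "\<And>t j. t < T \<Longrightarrow> j < K \<Longrightarrow> (\<lambda>\<omega>. adv t \<omega> j) \<in> borel_measurable \<Omega>"
    and \<alpha>: "0 \<le> \<alpha>" "\<alpha> \<le> 1"
    and \<eta>: "0 < \<eta>"
    and \<epsilon>: "0 < \<epsilon>" "real K * \<epsilon> \<le> 1"
begin

abbreviation "Z \<equiv> zst K \<alpha> \<eta> \<epsilon> \<epsilon> adv"
abbreviation "X \<equiv> xst K \<alpha> \<eta> \<epsilon> \<epsilon> adv"
abbreviation "A \<equiv> act K \<alpha> \<eta> \<epsilon> \<epsilon> adv"

text \<open>The regularized loss estimate, \<open>\<ell>\<close> with a tilde in the paper.\<close>

definition tilted :: "nat \<Rightarrow> (nat \<Rightarrow> rnd) \<Rightarrow> nat \<Rightarrow> real" where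
  "tilted t \<omega> = (\<lambda>j. (if j = A t \<omega> then adv t \<omega> (A t \<omega>) / X t \<omega> j else 0)
     + \<epsilon> * pgrad (Reg K \<epsilon>) (X t \<omega>) j)"

lemma Z_Suc: "Z (Suc t) \<omega> = mstep K (phi K \<alpha>) \<eta> (tilted t \<omega>) (X t \<omega>)"
  unfolding tilted_def xst_def act_def zst.simps Let_def ..

lemma X_Suc: "X (Suc t) \<omega> = proj K (phi K \<alpha>) \<epsilon> (mstep K (phi K \<alpha>) \<eta> (tilted t \<omega>) (X t \<omega>))"
  unfolding xst_def[of _ _ _ _ _ _ "Suc t"] Z_Suc ..

lemma A_less: "A t \<omega> < K"
  unfolding act_def by (rule sample_less[OF K])

lemma dual_proj_X_if_Z: "Z t \<omega> \<in> posorth K \<Longrightarrow> dual_proj K \<alpha> \<epsilon> (\<lambda>i. psi \<alpha> (Z t \<omega> i)) (X t \<omega>)"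
  unfolding xst_def using K \<epsilon> \<alpha> by (intro dual_proj_proj) auto

lemma Z_posorth: "\<omega> \<in> space \<Omega> \<Longrightarrow> t \<le> T \<Longrightarrow> Z t \<omega> \<in> posorth K"
proof (induction t)
  case 0
  then show ?case using K by (auto simp: posorth_def)
next
  case (Suc t)
  then have "X t \<omega> \<in> simplex_eps K \<epsilon>" using dual_proj_X_if_Z[of t \<omega>] by (auto simp: dual_proj_def)
  then show ?case unfolding Z_Suc using Suc.prems
    by (intro regularized_exp3_step(1)[OF _ _ A_less _ _ \<eta> tilted_def refl])
      (use adv_range[OF _ _ A_less] \<epsilon> \<alpha> in auto)
qed

lemma dual_proj_X:
  "\<omega> \<in> space \<Omega> \<Longrightarrow> t \<le> T \<Longrightarrow> dual_proj K \<alpha> \<epsilon> (\<lambda>i. psi \<alpha> (Z t \<omega> i)) (X t \<omega>)"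
  by (intro dual_proj_X_if_Z Z_posorth)

lemma X_simplex: "\<omega> \<in> space \<Omega> \<Longrightarrow> t \<le> T \<Longrightarrow> X t \<omega> \<in> simplex_eps K \<epsilon>"
  using dual_proj_X by (auto simp: dual_proj_def)

lemma X_bounds:
  assumes "\<omega> \<in> space \<Omega>" "t \<le> T" "i < K"
  shows "\<epsilon> \<le> X t \<omega> i" "0 < X t \<omega> i" "X t \<omega> i \<le> 1"
  using simplex_epsD[OF X_simplex[OF assms(1,2)] \<epsilon>(1) assms(3)] by auto

text \<open>The seed of round \<open>t\<close> enters only after \<open>X t\<close> has been formed,
  so \<open>reseed t\<close> leaves \<open>X t\<close> unchanged.\<close>

lemma X_causal: "t \<le> T \<Longrightarrow> (\<And>s. s < t \<Longrightarrow> \<omega> s = \<omega>' s) \<Longrightarrow> X t \<omega> = X t \<omega>'"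
proof (induction t)
  case 0
  then show ?case by (simp add: xst_def)
next
  case (Suc t)
  have X: "X t \<omega> = X t \<omega>'" using Suc by auto
  have A: "A t \<omega> = A t \<omega>'" unfolding act_def X using Suc.prems by simp
  have adv: "adv t \<omega> = adv t \<omega>'" using Suc.prems by (intro adv_causal) auto
  have "tilted t \<omega> = tilted t \<omega>'" unfolding tilted_def A X adv ..
  then show ?case unfolding X_Suc X by simp
qed

text \<open>The one-round inequalities telescope, for every realization of the randomness.\<close>

lemma pathwise_bound:
  assumes \<omega>: "\<omega> \<in> space \<Omega>" and u: "u \<in> simplex_eps K \<epsilon>" and n: "n \<le> T"
  shows "\<eta> * (\<Sum>t<n. adv t \<omega> (A t \<omega>) - adv t \<omega> (A t \<omega>) * u (A t \<omega>) / X t \<omega> (A t \<omega>)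
        - (real K - 1) * \<epsilon> - \<eta> * (3 + 1 / X t \<omega> (A t \<omega>)))
    \<le> (\<Sum>i<K. breg1 \<alpha> (u i) (1 / real K)) - (\<Sum>i<K. breg1 \<alpha> (u i) (X n \<omega> i))"
  using n
proof (induction n)
  case 0
  \<comment> \<open>Projecting the uniform start cannot increase the divergence, so the telescoped
    sum starts from the uniform point.\<close>
  have "(\<Sum>i<K. breg1 \<alpha> (u i) (X 0 \<omega> i)) \<le> (\<Sum>i<K. breg1 \<alpha> (u i) (Z 0 \<omega> i))"
    using dual_proj_X[OF \<omega>, of 0] Z_posorth[OF \<omega>, of 0] u \<epsilon> \<alpha>
    by (intro dual_proj_pythagoras) (auto simp: posorth_def)
  then show ?case by simp
next
  case (Suc n)
  have "\<eta> * (adv n \<omega> (A n \<omega>) - adv n \<omega> (A n \<omega>) * u (A n \<omega>) / X n \<omega> (A n \<omega>)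
        - (real K - 1) * \<epsilon> - \<eta> * (3 + 1 / X n \<omega> (A n \<omega>)))
      \<le> (\<Sum>i<K. breg1 \<alpha> (u i) (X n \<omega> i)) - (\<Sum>i<K. breg1 \<alpha> (u i) (X (Suc n) \<omega> i))"
    using Suc.prems
    by (intro regularized_exp3_step(2)[OF X_simplex[OF \<omega>] u A_less _ _ \<eta> tilted_def X_Suc])
      (use adv_range[OF _ \<omega> A_less] \<epsilon> \<alpha> in auto)
  then show ?case using Suc by (simp add: distrib_left)
qed

lemma pathwise_regret:
  assumes \<omega>: "\<omega> \<in> space \<Omega>" and u: "u \<in> simplex_eps K \<epsilon>"
  shows "(\<Sum>t<T. adv t \<omega> (A t \<omega>)) \<le> (\<Sum>i<K. breg1 \<alpha> (u i) (1 / real K)) / \<eta>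
    + real T * ((real K - 1) * \<epsilon>)
    + (\<Sum>t<T. adv t \<omega> (A t \<omega>) * u (A t \<omega>) / X t \<omega> (A t \<omega>) + \<eta> * (3 + 1 / X t \<omega> (A t \<omega>)))"
proof -
  have "0 \<le> (\<Sum>i<K. breg1 \<alpha> (u i) (X T \<omega> i))"
    using X_bounds[OF \<omega>] simplex_epsD[OF u \<epsilon>(1)] \<alpha> by (intro sum_nonneg breg1_nonneg) auto
  then have "\<eta> * (\<Sum>t<T. adv t \<omega> (A t \<omega>) - adv t \<omega> (A t \<omega>) * u (A t \<omega>) / X t \<omega> (A t \<omega>)
        - (real K - 1) * \<epsilon> - \<eta> * (3 + 1 / X t \<omega> (A t \<omega>))) \<le> (\<Sum>i<K. breg1 \<alpha> (u i) (1 / real K))"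
    using pathwise_bound[OF \<omega> u order_refl] by linarith
  then have "(\<Sum>t<T. adv t \<omega> (A t \<omega>) - adv t \<omega> (A t \<omega>) * u (A t \<omega>) / X t \<omega> (A t \<omega>)
        - (real K - 1) * \<epsilon> - \<eta> * (3 + 1 / X t \<omega> (A t \<omega>))) \<le> (\<Sum>i<K. breg1 \<alpha> (u i) (1 / real K)) / \<eta>"
    using \<eta> by (simp add: field_simps)
  then show ?thesis by (simp add: sum_subtractf sum.distrib)
qed

sublocale D: prob_space D by (rule D_prob)
sublocale U: prob_space unif01 by (rule prob_space_unif01)
sublocale R: prob_space "round_measure D"
  by (intro prob_space_pair D_prob prob_space_unif01)
sublocale P: prob_space \<Omega>
  unfolding \<Omega>_def by (intro prob_space_PiM R.prob_space_axioms)

lemma measurable_coord: "t < T \<Longrightarrow> (\<lambda>\<omega>. \<omega> t) \<in> measurable \<Omega> (round_measure D)"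
  unfolding \<Omega>_def by (intro measurable_component_singleton) auto

lemma measurable_D_coord: "j < K \<Longrightarrow> (\<lambda>l. l j) \<in> borel_measurable D"
  unfolding measurable_cong_sets[OF D_sets refl] by (intro measurable_component_singleton) auto

lemma measurable_loss: "t < T \<Longrightarrow> j < K \<Longrightarrow> (\<lambda>\<omega>. fst (\<omega> t) j) \<in> borel_measurable \<Omega>"
  using measurable_compose[OF measurable_compose[OF measurable_coord measurable_fst] measurable_D_coord]
  by simp

lemma measurable_learner_seed: "t < T \<Longrightarrow> (\<lambda>\<omega>. fst (snd (\<omega> t))) \<in> borel_measurable \<Omega>"
proof -
  assume "t < T"
  note [measurable] = measurable_coord[OF this]
  have "(\<lambda>\<omega>. fst (snd (\<omega> t))) \<in> measurable \<Omega> unif01" by measurable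
  also have "measurable \<Omega> unif01 = borel_measurable \<Omega>" by (intro measurable_cong_sets) auto
  finally show ?thesis .
qed

text \<open>The choice operators in \<open>mstep\<close> and \<open>proj\<close> give no direct
  access to measurability. But the gradient after a mirror step is an explicit function of the
  round, and \<open>X (Suc t)\<close> solves the projection condition for it.\<close>

lemma measurable_X: "t \<le> T \<Longrightarrow> (\<lambda>\<omega>. X t \<omega> i) \<in> borel_measurable \<Omega>"
proof (induction t arbitrary: i)
  case 0
  then show ?case by (simp add: xst_def)
next
  case (Suc t)
  show ?case
  proof (cases "i < K")
    case False
    then have "X (Suc t) \<omega> i = 0" if "\<omega> \<in> space \<Omega>" for \<omega>
      using X_simplex[OF that Suc.prems] by (auto simp: simplex_eps_def)
    then show ?thesis by (simp cong: measurable_cong)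
  next
    case True
    have t: "t < T" using Suc.prems by simp
    have [measurable]: "(\<lambda>\<omega>. X t \<omega> i) \<in> borel_measurable \<Omega>" for i using Suc by auto
    note [measurable] = measurable_learner_seed[OF t] adv_meas[OF t]
    have [measurable]: "A t \<in> measurable \<Omega> (count_space UNIV)"
      unfolding act_def[abs_def] by (intro measurable_sample) auto
    \<comment> \<open>The gradient \<open>psi \<alpha> (Z (Suc t) \<omega> i)\<close>, written
      without choice operators.\<close>
    define w where "w = (\<lambda>\<omega> i. psi \<alpha> (X t \<omega> i) -
      \<eta> * ((if A t \<omega> = i then adv t \<omega> i / X t \<omega> i else 0) + \<epsilon> * (1 / \<epsilon> - 1 / X t \<omega> i)))"
    show ?thesis
    proof (rule measurable_dual_proj[OF _ _ True \<epsilon>(2,1) \<alpha>])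
      show "(\<lambda>\<omega>. w \<omega> i) \<in> borel_measurable \<Omega>" if "i < K" for i
        using adv_meas[OF t that] unfolding w_def by measurable
      show "dual_proj K \<alpha> \<epsilon> (w \<omega>) (X (Suc t) \<omega>)" if \<omega>: "\<omega> \<in> space \<Omega>" for \<omega>
      proof -
        have x: "X t \<omega> \<in> simplex_eps K \<epsilon>" using X_simplex[OF \<omega>, of t] t by simp
        have xp: "\<epsilon> \<le> X t \<omega> i" "0 < X t \<omega> i" if "i < K" for i
          using simplex_epsD[OF x \<epsilon>(1) that] by auto
        have l: "tilted t \<omega> i = (if A t \<omega> = i then adv t \<omega> i / X t \<omega> i else 0) + \<epsilon> * (1 / \<epsilon> - 1 / X t \<omega> i)"
          if "i < K" for i
          using xp[OF that] that by (auto simp: tilted_def pgrad_Reg)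
        have "psi \<alpha> (Z (Suc t) \<omega> i) = w \<omega> i" if i: "i < K" for i
        proof -
          have "psi \<alpha> (mstep K (phi K \<alpha>) \<eta> (tilted t \<omega>) (X t \<omega>) i) = psi \<alpha> (X t \<omega> i) - \<eta> * tilted t \<omega> i"
          proof (rule mstep_phi(2)[OF _ _ \<alpha> i])
            show "X t \<omega> \<in> posorth K" using xp x by (auto simp: posorth_def simplex_eps_def)
            show "0 \<le> \<eta> * tilted t \<omega> i" if "i < K" for i
              using \<eta> \<epsilon> xp[OF that] adv_range[OF t \<omega> that] unfolding l[OF that]
              by (intro mult_nonneg_nonneg add_nonneg_nonneg) (auto simp: frac_le)
          qed
          then show ?thesis unfolding Z_Suc w_def l[OF i] .
        qed
        then show ?thesis using dual_proj_X[OF \<omega> Suc.prems] by (simp add: dual_proj_def)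
      qed
    qed
  qed
qed

lemma measurable_A: "t < T \<Longrightarrow> A t \<in> measurable \<Omega> (count_space UNIV)"
  unfolding act_def[abs_def]
  by (intro measurable_sample measurable_learner_seed measurable_X) auto

lemma measurable_select:
  assumes t: "t < T" and F: "\<And>j. j < K \<Longrightarrow> F j \<in> borel_measurable \<Omega>"
  shows "(\<lambda>\<omega>. F (A t \<omega>) \<omega> :: real) \<in> borel_measurable \<Omega>"
proof -
  note [measurable] = measurable_A[OF t]
  have "(\<lambda>\<omega>. \<Sum>j<K. if A t \<omega> = j then F j \<omega> else 0) \<in> borel_measurable \<Omega>"
  proof (intro borel_measurable_sum)
    fix j assume "j \<in> {..<K}"
    then have [measurable]: "F j \<in> borel_measurable \<Omega>" using F by auto
    show "(\<lambda>\<omega>. if A t \<omega> = j then F j \<omega> else 0) \<in> borel_measurable \<Omega>" by measurable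
  qed
  moreover have "(\<Sum>j<K. if A t \<omega> = j then F j \<omega> else 0) = F (A t \<omega>) \<omega>" for \<omega>
    using A_less[of t \<omega>] by (simp add: sum.delta')
  ultimately show ?thesis by simp
qed

text \<open>\<open>F\<close> and \<open>X t\<close> are fixed before the arm is drawn, and given
  these arm \<open>j\<close> has probability at most \<open>X t \<omega> j\<close>. The bound
  \<open>B\<close> serves integrability.\<close>

lemma expectation_select_le:
  assumes t: "t < T" and F: "\<And>j. j < K \<Longrightarrow> F j \<in> borel_measurable \<Omega>"
    and F0: "\<And>j \<omega>. j < K \<Longrightarrow> \<omega> \<in> space \<Omega> \<Longrightarrow> 0 \<le> F j \<omega> \<and> F j \<omega> \<le> B"
    and causal: "\<And>j \<omega> u. j < K \<Longrightarrow> F j (reseed t u \<omega>) = F j \<omega>"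
  shows "integrable \<Omega> (\<lambda>\<omega>. F (A t \<omega>) \<omega>)"
    and "(\<integral>\<omega>. F (A t \<omega>) \<omega> \<partial>\<Omega>) \<le> (\<integral>\<omega>. (\<Sum>j<K. X t \<omega> j * F j \<omega>) \<partial>\<Omega>)"
proof -
  have B: "0 \<le> B" using F0[of 0] K P.not_empty by fastforce
  note mF[measurable] = measurable_select[of t F, OF t F]
  have xF: "0 \<le> X t \<omega> j * F j \<omega>" "X t \<omega> j * F j \<omega> \<le> B" if "j < K" "\<omega> \<in> space \<Omega>" for j \<omega>
  proof -
    have "0 < X t \<omega> j" "X t \<omega> j \<le> 1" using X_bounds[OF that(2) _ that(1)] t by auto
    then show "0 \<le> X t \<omega> j * F j \<omega>" "X t \<omega> j * F j \<omega> \<le> B"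
      using F0[OF that] mult_mono[of "X t \<omega> j" 1 "F j \<omega>" B] by auto
  qed
  show int: "integrable \<Omega> (\<lambda>\<omega>. F (A t \<omega>) \<omega>)"
    using F0[OF A_less] by (intro P.integrable_const_bound[of _ B] AE_I2) (auto simp: mF)
  have int2: "integrable \<Omega> (\<lambda>\<omega>. \<Sum>j<K. X t \<omega> j * F j \<omega>)"
  proof (intro Bochner_Integration.integrable_sum P.integrable_const_bound[of _ B] AE_I2)
    show "norm (X t \<omega> j * F j \<omega>) \<le> B" if "j \<in> {..<K}" "\<omega> \<in> space \<Omega>" for j \<omega>
      using xF[of j \<omega>] that by auto
    show "(\<lambda>\<omega>. X t \<omega> j * F j \<omega>) \<in> borel_measurable \<Omega>" if "j \<in> {..<K}" for j
      using measurable_X[of t j] F[of j] that t by (intro borel_measurable_times) auto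
  qed
  have "ennreal (\<integral>\<omega>. F (A t \<omega>) \<omega> \<partial>\<Omega>) = (\<integral>\<^sup>+\<omega>. ennreal (F (A t \<omega>) \<omega>) \<partial>\<Omega>)"
    using F0[OF A_less] by (intro nn_integral_eq_integral[symmetric] int AE_I2) auto
  \<comment> \<open>With a fresh seed, the argument of \<open>sample\<close> is the only thing that
    changes.\<close>
  also have "\<dots> = (\<integral>\<^sup>+\<omega>. (\<integral>\<^sup>+u. ennreal (F (sample K (X t \<omega>) u) \<omega>) \<partial>unif01) \<partial>\<Omega>)"
  proof -
    have "X t (reseed t u \<omega>) = X t \<omega>" for \<omega> u
      using t by (intro X_causal) (auto simp: reseed_def)
    then have "F (A t (reseed t u \<omega>)) (reseed t u \<omega>)
      = F (sample K (X t \<omega>) u) \<omega>" for \<omega> u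
      using causal[OF sample_less[OF K]] by (simp add: act_def) (simp add: reseed_def)
    then show ?thesis
      using nn_integral_PiM_resample[OF D_prob prob_space_unif01 prob_space_unif01 t,
          of "\<lambda>\<omega>. ennreal (F (A t \<omega>) \<omega>)"] mF
      unfolding \<Omega>_def by simp
  qed
  also have "\<dots> \<le> (\<integral>\<^sup>+\<omega>. ennreal (\<Sum>j<K. X t \<omega> j * F j \<omega>) \<partial>\<Omega>)"
  proof (rule nn_integral_mono)
    fix \<omega> assume \<omega>: "\<omega> \<in> space \<Omega>"
    have xp: "0 \<le> X t \<omega> j" if "j < K" for j using X_bounds(2)[OF \<omega> _ that, of t] t by simp
    have "(\<integral>\<^sup>+u. ennreal (F (sample K (X t \<omega>) u) \<omega>) \<partial>unif01) \<le> (\<Sum>j<K. ennreal (X t \<omega> j) * ennreal (F j \<omega>))"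
      using simplex_eps_sum[OF X_simplex[OF \<omega>, of t]] xp K t by (intro nn_integral_sample_le) auto
    also have "\<dots> = (\<Sum>j<K. ennreal (X t \<omega> j * F j \<omega>))"
      using xp F0[OF _ \<omega>] by (intro sum.cong refl ennreal_mult[symmetric]) auto
    also have "\<dots> = ennreal (\<Sum>j<K. X t \<omega> j * F j \<omega>)"
      using xF[OF _ \<omega>] by (intro sum_ennreal) auto
    finally show "(\<integral>\<^sup>+u. ennreal (F (sample K (X t \<omega>) u) \<omega>) \<partial>unif01) \<le> ennreal (\<Sum>j<K. X t \<omega> j * F j \<omega>)" .
  qed
  also have "\<dots> = ennreal (\<integral>\<omega>. (\<Sum>j<K. X t \<omega> j * F j \<omega>) \<partial>\<Omega>)"
    using xF by (intro nn_integral_eq_integral int2 AE_I2 sum_nonneg) auto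
  finally show "(\<integral>\<omega>. F (A t \<omega>) \<omega> \<partial>\<Omega>) \<le> (\<integral>\<omega>. (\<Sum>j<K. X t \<omega> j * F j \<omega>) \<partial>\<Omega>)"
    using xF by (subst (asm) ennreal_le_iff) (auto intro!: integral_nonneg_AE AE_I2 sum_nonneg)
qed

section \<open>Expected losses, corruption and regret\<close>

lemma AE_loss_range: "t < T \<Longrightarrow> AE \<omega> in \<Omega>. \<forall>j<K. 0 \<le> fst (\<omega> t) j \<and> fst (\<omega> t) j \<le> 1"
proof -
  assume t: "t < T"
  have "AE l in distr (round_measure D) D fst. \<forall>j<K. 0 \<le> l j \<and> l j \<le> 1"
    unfolding prob_space.distr_pair_fst[OF prob_space_pair[OF prob_space_unif01 prob_space_unif01]]
    by (rule D_range)
  then have "AE y in round_measure D. \<forall>j<K. 0 \<le> fst y j \<and> fst y j \<le> 1"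
    by (rule AE_distrD[rotated]) measurable
  then show ?thesis unfolding \<Omega>_def using t
    by (intro AE_PiM_component[where P = "\<lambda>y. \<forall>j<K. 0 \<le> fst y j \<and> fst y j \<le> 1"] R.prob_space_axioms) auto
qed

lemma expectation_loss:
  assumes t: "t < T" and j: "j < K"
  shows "(\<integral>\<omega>. fst (\<omega> t) j \<partial>\<Omega>) = (\<integral>l. l j \<partial>D)"
proof -
  have "(\<integral>\<omega>. fst (\<omega> t) j \<partial>\<Omega>) = (\<integral>y. fst y j \<partial>distr \<Omega> (round_measure D) (\<lambda>\<omega>. \<omega> t))"
    using measurable_compose[OF measurable_fst measurable_D_coord[OF j]]
    by (intro integral_distr[symmetric] measurable_coord[OF t]) auto
  also have "distr \<Omega> (round_measure D) (\<lambda>\<omega>. \<omega> t) = round_measure D"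
    unfolding \<Omega>_def using t by (intro distr_PiM_component R.prob_space_axioms) auto
  also have "(\<integral>y. fst y j \<partial>round_measure D) = (\<integral>l. l j \<partial>distr (round_measure D) D fst)"
    by (intro integral_distr[symmetric] measurable_fst measurable_D_coord[OF j])
  also have "distr (round_measure D) D fst = D"
    by (intro prob_space.distr_pair_fst prob_space_pair prob_space_unif01)
  finally show ?thesis .
qed

abbreviation corruption :: "nat \<Rightarrow> (nat \<Rightarrow> rnd) \<Rightarrow> real" where
  "corruption t \<omega> \<equiv> MAX j\<in>{..<K}. \<bar>adv t \<omega> j - fst (\<omega> t) j\<bar>"

lemma corruption_ge: "j < K \<Longrightarrow> \<bar>adv t \<omega> j - fst (\<omega> t) j\<bar> \<le> corruption t \<omega>"
  by (intro Max_ge) auto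

lemma integrable_corruption:
  assumes t: "t < T"
  shows "integrable \<Omega> (corruption t)"
proof (rule P.integrable_const_bound[of _ 1])
  show "AE \<omega> in \<Omega>. norm (corruption t \<omega>) \<le> 1"
    using AE_loss_range[OF t] AE_space
  proof eventually_elim
    case (elim \<omega>)
    have "\<bar>adv t \<omega> j - fst (\<omega> t) j\<bar> \<le> 1" if "j < K" for j
      using adv_range[OF t elim(2) that] elim(1) that by (auto simp: abs_le_iff)
    then have "corruption t \<omega> \<le> 1" using K by (intro Max.boundedI) (auto simp: lessThan_empty_iff)
    moreover have "0 \<le> corruption t \<omega>"
      using corruption_ge[of 0 t \<omega>] K abs_ge_zero order_trans by (metis less_le_trans zero_less_one)
    ultimately show ?case by simp
  qed
  show "corruption t \<in> borel_measurable \<Omega>"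
    using adv_meas[OF t] measurable_loss[OF t]
    by (intro borel_measurable_Max borel_measurable_abs borel_measurable_diff) auto
qed

lemma integrable_loss: "t < T \<Longrightarrow> j < K \<Longrightarrow> integrable \<Omega> (\<lambda>\<omega>. fst (\<omega> t) j)"
  using AE_loss_range[of t]
  by (intro P.integrable_const_bound[of _ 1] measurable_loss) (auto elim!: eventually_mono)

lemma integrable_loss_A:
  assumes t: "t < T"
  shows "integrable \<Omega> (\<lambda>\<omega>. fst (\<omega> t) (A t \<omega>))"
  using AE_loss_range[OF t] A_less[of t] measurable_select[OF t, of "\<lambda>j \<omega>. fst (\<omega> t) j"] measurable_loss[OF t]
  by (intro P.integrable_const_bound[of _ 1]) (auto elim!: eventually_mono)

lemma integrable_adv: "t < T \<Longrightarrow> j < K \<Longrightarrow> integrable \<Omega> (\<lambda>\<omega>. adv t \<omega> j)"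
  using adv_range[of t]
  by (intro P.integrable_const_bound[of _ 1] adv_meas AE_I2) auto

lemma integral_mean_nonneg: "j < K \<Longrightarrow> 0 \<le> (\<integral>l. l j \<partial>D)"
  using D_range by (intro integral_nonneg_AE) (auto elim!: eventually_mono)

lemma expected_loss_le_horizon: "(\<integral>\<omega>. (\<Sum>t<T. fst (\<omega> t) (A t \<omega>)) \<partial>\<Omega>) \<le> real T"
proof -
  have "(\<integral>\<omega>. (\<Sum>t<T. fst (\<omega> t) (A t \<omega>)) \<partial>\<Omega>) = (\<Sum>t<T. \<integral>\<omega>. fst (\<omega> t) (A t \<omega>) \<partial>\<Omega>)"
    by (intro Bochner_Integration.integral_sum integrable_loss_A) auto
  also have "\<dots> \<le> (\<Sum>t<T. 1)"
  proof (intro sum_mono P.integral_le_const integrable_loss_A)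
    show "AE \<omega> in \<Omega>. fst (\<omega> t) (A t \<omega>) \<le> 1" if "t \<in> {..<T}" for t
      using AE_loss_range[of t] that A_less by (auto elim!: eventually_mono)
  qed auto
  finally show ?thesis by simp
qed

text \<open>Expectation of \<open>pathwise_regret\<close>. The corruption counts twice, for the
  learner's losses and for those of the comparator; so does
  \<open>(real K - 1) * \<epsilon>\<close>, for the regularizer and for mixing the
  comparator.\<close>

lemma expected_regret_le:
  assumes a: "a < K" and B: "(\<Sum>i<K. breg1 \<alpha> (mixed_arm K \<epsilon> a i) (1 / real K)) \<le> B"
  shows "(\<integral>\<omega>. (\<Sum>t<T. fst (\<omega> t) (A t \<omega>)) \<partial>\<Omega>) - real T * (\<integral>l. l a \<partial>D)
    \<le> B / \<eta> + real T * (2 * (real K - 1) * \<epsilon> + \<eta> * (3 + real K))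
      + 2 * (\<Sum>t<T. \<integral>\<omega>. corruption t \<omega> \<partial>\<Omega>)"
proof -
  let ?u = "mixed_arm K \<epsilon> a"
  have u: "?u \<in> simplex_eps K \<epsilon>" by (rule mixed_arm_in_simplex_eps[OF a \<epsilon>(2)])
  have up: "0 < ?u j" "?u j \<le> 1" if "j < K" for j using simplex_epsD[OF u \<epsilon>(1) that] by auto
  define F where "F = (\<lambda>t j \<omega>. adv t \<omega> j * ?u j / X t \<omega> j + \<eta> * (3 + 1 / X t \<omega> j))"
  have F: "integrable \<Omega> (\<lambda>\<omega>. F t (A t \<omega>) \<omega>)"
    "(\<integral>\<omega>. F t (A t \<omega>) \<omega> \<partial>\<Omega>) \<le> (\<integral>\<omega>. (\<Sum>j<K. X t \<omega> j * F t j \<omega>) \<partial>\<Omega>)" if t: "t < T" for t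
  proof -
    have 1: "F t j \<in> borel_measurable \<Omega>" if "j < K" for j
      using adv_meas[OF t that] measurable_X[of t j] t unfolding F_def by (auto intro!: measurable)
    have 2: "0 \<le> F t j \<omega> \<and> F t j \<omega> \<le> 1 / \<epsilon> + \<eta> * (3 + 1 / \<epsilon>)" if j: "j < K" and \<omega>: "\<omega> \<in> space \<Omega>" for j \<omega>
    proof -
      have x: "\<epsilon> \<le> X t \<omega> j" "0 < X t \<omega> j" using X_bounds[OF \<omega> _ j, of t] t by auto
      have c: "0 \<le> adv t \<omega> j * ?u j" "adv t \<omega> j * ?u j \<le> 1"
        using adv_range[OF t \<omega> j] up[OF j] by (auto intro: mult_le_one)
      have "1 / X t \<omega> j \<le> 1 / \<epsilon>" using x \<epsilon> by (simp add: frac_le)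
      moreover have "adv t \<omega> j * ?u j / X t \<omega> j \<le> 1 / \<epsilon>" using x c \<epsilon> by (intro frac_le) auto
      ultimately show ?thesis unfolding F_def using x c \<eta>
        by (intro conjI add_nonneg_nonneg add_mono mult_left_mono) auto
    qed
    \<comment> \<open>Resampling preserves exactly the data on which \<open>adv_causal\<close> lets
      the adversary depend.\<close>
    have 3: "F t j (reseed t v \<omega>) = F t j \<omega>" for j \<omega> v
    proof -
      have "X t (reseed t v \<omega>) = X t \<omega>" using t by (intro X_causal) (auto simp: reseed_def)
      moreover have "adv t (reseed t v \<omega>) = adv t \<omega>"
        using t by (intro adv_causal) (auto simp: reseed_def)
      ultimately show ?thesis unfolding F_def by simp
    qed
    show "integrable \<Omega> (\<lambda>\<omega>. F t (A t \<omega>) \<omega>)"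
      "(\<integral>\<omega>. F t (A t \<omega>) \<omega> \<partial>\<Omega>) \<le> (\<integral>\<omega>. (\<Sum>j<K. X t \<omega> j * F t j \<omega>) \<partial>\<Omega>)"
      using expectation_select_le[of t "F t", OF t 1 2 3] by auto
  qed
  have round: "(\<integral>\<omega>. F t (A t \<omega>) \<omega> \<partial>\<Omega>) \<le> (\<integral>l. l a \<partial>D) + (\<integral>\<omega>. corruption t \<omega> \<partial>\<Omega>)
      + ((real K - 1) * \<epsilon> + \<eta> * (3 + real K))" if t: "t < T" for t
  proof -
    have "(\<integral>\<omega>. F t (A t \<omega>) \<omega> \<partial>\<Omega>) \<le> (\<integral>\<omega>. (\<Sum>j<K. X t \<omega> j * F t j \<omega>) \<partial>\<Omega>)" by (rule F(2)[OF t])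
    \<comment> \<open>Averaging over the arms cancels the importance weights:
      \<open>1 / X t \<omega> j\<close> contributes 1 for each arm, \<open>K\<close> in
      total.\<close>
    also have "\<dots> = (\<integral>\<omega>. (\<Sum>j<K. adv t \<omega> j * ?u j) + \<eta> * (3 + real K) \<partial>\<Omega>)"
    proof (intro Bochner_Integration.integral_cong refl)
      fix \<omega> assume \<omega>: "\<omega> \<in> space \<Omega>"
      have "(\<Sum>j<K. X t \<omega> j * F t j \<omega>) = (\<Sum>j<K. adv t \<omega> j * ?u j + \<eta> * (3 * X t \<omega> j + 1))"
      proof (intro sum.cong refl)
        fix j assume "j \<in> {..<K}"
        then have "0 < X t \<omega> j" using X_bounds(2)[OF \<omega>, of t j] t by auto
        then show "X t \<omega> j * F t j \<omega> = adv t \<omega> j * ?u j + \<eta> * (3 * X t \<omega> j + 1)"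
          by (simp add: F_def field_simps)
      qed
      also have "\<dots> = (\<Sum>j<K. adv t \<omega> j * ?u j) + \<eta> * (3 * (\<Sum>j<K. X t \<omega> j) + real K)"
        by (simp add: sum.distrib sum_distrib_left[symmetric])
      finally show "(\<Sum>j<K. X t \<omega> j * F t j \<omega>) = (\<Sum>j<K. adv t \<omega> j * ?u j) + \<eta> * (3 + real K)"
        using simplex_eps_sum[OF X_simplex[OF \<omega>, of t]] t by simp
    qed
    also have "\<dots> \<le> (\<integral>\<omega>. fst (\<omega> t) a + corruption t \<omega> + ((real K - 1) * \<epsilon> + \<eta> * (3 + real K)) \<partial>\<Omega>)"
    proof (rule integral_mono)
      show "integrable \<Omega> (\<lambda>\<omega>. (\<Sum>j<K. adv t \<omega> j * ?u j) + \<eta> * (3 + real K))"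
        using integrable_adv[OF t]
        by (intro Bochner_Integration.integrable_add Bochner_Integration.integrable_sum integrable_mult_left) auto
      show "integrable \<Omega> (\<lambda>\<omega>. fst (\<omega> t) a + corruption t \<omega> + ((real K - 1) * \<epsilon> + \<eta> * (3 + real K)))"
        using integrable_loss[OF t a] integrable_corruption[OF t] by auto
      fix \<omega> assume \<omega>: "\<omega> \<in> space \<Omega>"
      have "(\<Sum>j<K. adv t \<omega> j * ?u j) = adv t \<omega> a * ?u a + (\<Sum>j\<in>{..<K} - {a}. adv t \<omega> j * ?u j)"
        using a by (subst sum.remove[of _ a]) auto
      \<comment> \<open>Arm \<open>a\<close> has weight at most 1; each other arm has weight
        \<open>\<epsilon>\<close> and loss at most 1.\<close>
      also have "\<dots> \<le> adv t \<omega> a * 1 + (\<Sum>j\<in>{..<K} - {a}. \<epsilon>)"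
      proof (intro add_mono sum_mono mult_left_mono)
        show "adv t \<omega> j * ?u j \<le> \<epsilon>" if "j \<in> {..<K} - {a}" for j
          using adv_range[OF t \<omega>, of j] that \<epsilon> by (auto simp: mixed_arm_def mult_left_le_one_le)
      qed (use up[OF a] adv_range[OF t \<omega> a] in auto)
      also have "\<dots> = adv t \<omega> a + (real K - 1) * \<epsilon>" using a by simp
      also have "adv t \<omega> a \<le> fst (\<omega> t) a + corruption t \<omega>"
        using corruption_ge[OF a, of t \<omega>] by linarith
      finally show "(\<Sum>j<K. adv t \<omega> j * ?u j) + \<eta> * (3 + real K)
          \<le> fst (\<omega> t) a + corruption t \<omega> + ((real K - 1) * \<epsilon> + \<eta> * (3 + real K))" by simp
    qed
    also have "\<dots> = (\<integral>l. l a \<partial>D) + (\<integral>\<omega>. corruption t \<omega> \<partial>\<Omega>) + ((real K - 1) * \<epsilon> + \<eta> * (3 + real K))"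
      using integrable_loss[OF t a] integrable_corruption[OF t] expectation_loss[OF t a]
      by (simp add: P.prob_space)
    finally show ?thesis .
  qed
  have "(\<integral>\<omega>. (\<Sum>t<T. fst (\<omega> t) (A t \<omega>)) \<partial>\<Omega>)
      \<le> (\<integral>\<omega>. B / \<eta> + real T * ((real K - 1) * \<epsilon>) + (\<Sum>t<T. F t (A t \<omega>) \<omega> + corruption t \<omega>) \<partial>\<Omega>)"
  proof (rule integral_mono)
    show "integrable \<Omega> (\<lambda>\<omega>. \<Sum>t<T. fst (\<omega> t) (A t \<omega>))"
      by (intro Bochner_Integration.integrable_sum integrable_loss_A) auto
    show "integrable \<Omega> (\<lambda>\<omega>. B / \<eta> + real T * ((real K - 1) * \<epsilon>) + (\<Sum>t<T. F t (A t \<omega>) \<omega> + corruption t \<omega>))"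
      using F(1) integrable_corruption
      by (intro Bochner_Integration.integrable_add Bochner_Integration.integrable_sum) auto
    fix \<omega> assume \<omega>: "\<omega> \<in> space \<Omega>"
    have "(\<Sum>t<T. fst (\<omega> t) (A t \<omega>)) \<le> (\<Sum>t<T. adv t \<omega> (A t \<omega>) + corruption t \<omega>)"
      using corruption_ge[OF A_less] by (intro sum_mono) (auto simp: abs_le_iff algebra_simps)
    moreover have "(\<Sum>t<T. adv t \<omega> (A t \<omega>)) \<le> (\<Sum>i<K. breg1 \<alpha> (?u i) (1 / real K)) / \<eta>
        + real T * ((real K - 1) * \<epsilon>) + (\<Sum>t<T. F t (A t \<omega>) \<omega>)"
      unfolding F_def by (rule pathwise_regret[OF \<omega> u])
    moreover have "(\<Sum>i<K. breg1 \<alpha> (?u i) (1 / real K)) / \<eta> \<le> B / \<eta>"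
      using B \<eta> by (intro divide_right_mono) auto
    ultimately show "(\<Sum>t<T. fst (\<omega> t) (A t \<omega>))
        \<le> B / \<eta> + real T * ((real K - 1) * \<epsilon>) + (\<Sum>t<T. F t (A t \<omega>) \<omega> + corruption t \<omega>)"
      unfolding sum.distrib by linarith
  qed
  also have "\<dots> = B / \<eta> + real T * ((real K - 1) * \<epsilon>)
      + (\<Sum>t<T. (\<integral>\<omega>. F t (A t \<omega>) \<omega> \<partial>\<Omega>) + (\<integral>\<omega>. corruption t \<omega> \<partial>\<Omega>))"
  proof -
    have int: "integrable \<Omega> (\<lambda>\<omega>. F t (A t \<omega>) \<omega> + corruption t \<omega>)" if "t \<in> {..<T}" for t
      using F(1) integrable_corruption that by (intro Bochner_Integration.integrable_add) auto
    have "(\<integral>\<omega>. (\<Sum>t<T. F t (A t \<omega>) \<omega> + corruption t \<omega>) \<partial>\<Omega>)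
        = (\<Sum>t<T. (\<integral>\<omega>. F t (A t \<omega>) \<omega> + corruption t \<omega> \<partial>\<Omega>))"
      by (intro Bochner_Integration.integral_sum int)
    also have "\<dots> = (\<Sum>t<T. (\<integral>\<omega>. F t (A t \<omega>) \<omega> \<partial>\<Omega>) + (\<integral>\<omega>. corruption t \<omega> \<partial>\<Omega>))"
      using F(1) integrable_corruption
      by (intro sum.cong refl Bochner_Integration.integral_add) auto
    finally show ?thesis
      by (subst Bochner_Integration.integral_add)
        (auto intro!: Bochner_Integration.integrable_sum int simp: P.prob_space)
  qed
  also have "\<dots> \<le> B / \<eta> + real T * ((real K - 1) * \<epsilon>)
      + (\<Sum>t<T. ((\<integral>l. l a \<partial>D) + (\<integral>\<omega>. corruption t \<omega> \<partial>\<Omega>)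
      + ((real K - 1) * \<epsilon> + \<eta> * (3 + real K))) + (\<integral>\<omega>. corruption t \<omega> \<partial>\<Omega>))"
    using round by (intro add_mono sum_mono) auto
  finally show ?thesis unfolding sum.distrib by (simp add: algebra_simps)
qed

end

section \<open>The regret bound\<close>

text \<open>Used with \<open>S = sqrt T\<close>. Up to \<open>21/5\<close>, the bound
  \<open>1 - 1 / S\<close> for \<open>ln S\<close> reduces the claim to a quadratic inequality;
  beyond, \<open>S\<close> is below \<open>exp 2\<close>, at most \<open>7.4\<close>, while
  \<open>ln S\<close> is at least \<open>ln 4\<close>, hence at least \<open>4/3\<close>. The lower
  end \<open>7/5\<close> stays below the square root of 2.\<close>

lemma le_mult_ln_if_small:
  fixes S :: real
  assumes "7/5 \<le> S" "2 * ln S < 4"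
  shows "S \<le> 14/5 * (2 * ln S)"
proof (cases "S \<le> 21/5")
  case True
  have ln_ge: "1 - 1 / S \<le> ln S" using ln_le_minus_one[of "1 / S"] assms by (simp add: ln_div)
  have "0 \<le> (S - 7/5) * (21/5 - S)" using True assms by (intro mult_nonneg_nonneg) auto
  moreover have "(S - 7/5) * (21/5 - S) = 28/5 * S - 147/25 - S * S" by (simp add: field_simps)
  ultimately have "S * S \<le> 28/5 * S - 28/5" by linarith
  then have "S \<le> 28/5 * (1 - 1 / S)" using assms by (simp add: field_simps)
  also have "\<dots> \<le> 28/5 * ln S" by (intro mult_left_mono ln_ge) simp
  finally show ?thesis by simp
next
  case False
  have "S < exp 2" using assms ln_less_cancel_iff[of S "exp 2"] by simp
  also have "exp 2 = (exp 1 :: real)\<^sup>2" by (simp flip: exp_of_nat_mult add: power2_eq_square mult_exp_exp)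
  also have "\<dots> \<le> 2.72\<^sup>2" using e_less_272 by (intro power_mono) auto
  finally have "S \<le> 7.4" by (simp add: power2_eq_square)
  moreover have "ln 4 \<le> ln S" using False by (subst ln_le_cancel_iff) auto
  moreover have "ln (4::real) = 2 * ln 2" using ln_realpow[of 2 2] by simp
  moreover have "ln (2::real) \<ge> 2/3" by (rule ln2_ge_two_thirds)
  ultimately show ?thesis by linarith
qed

theorem theorem4:
  fixes K T :: nat and \<alpha> \<beta> :: real
    and D :: "(nat \<Rightarrow> real) measure"
    and adv :: "nat \<Rightarrow> (nat \<Rightarrow> rnd) \<Rightarrow> nat \<Rightarrow> real"
  defines "\<Omega> \<equiv> Pi\<^sub>M {..<T} (\<lambda>_. D \<Otimes>\<^sub>M (uniform_measure lborel {0..1::real}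
                                         \<Otimes>\<^sub>M uniform_measure lborel {0..1::real}))"
    and "\<mu> \<equiv> (\<lambda>j. \<integral>l. l j \<partial>D)"
    and "\<eta> \<equiv> 1 / sqrt (real T)"
    and "\<epsilon> \<equiv> 1 / sqrt (real K) * real T powr (- (1/2 - \<beta>))"
  assumes K: "1 \<le> K" and T: "1 \<le> T"
    and D_prob: "prob_space D"
    and D_sets: "sets D = sets (Pi\<^sub>M {..<K} (\<lambda>_. borel))"
    and D_range: "AE l in D. \<forall>j<K. 0 \<le> l j \<and> l j \<le> 1"
    and adv_causal: "\<And>t \<omega> \<omega>'. t < T \<Longrightarrow> (\<forall>s<t. \<omega> s = \<omega>' s) \<Longrightarrow> fst (\<omega> t) = fst (\<omega>' t)
                       \<Longrightarrow> snd (snd (\<omega> t)) = snd (snd (\<omega>' t)) \<Longrightarrow> adv t \<omega> = adv t \<omega>'"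
    and adv_range: "\<And>t \<omega> j. t < T \<Longrightarrow> \<omega> \<in> space \<Omega> \<Longrightarrow> j < K \<Longrightarrow> 0 \<le> adv t \<omega> j \<and> adv t \<omega> j \<le> 1"
    and adv_meas: "\<And>t j. t < T \<Longrightarrow> j < K \<Longrightarrow> (\<lambda>\<omega>. adv t \<omega> j) \<in> borel_measurable \<Omega>"
    and \<beta>: "0 < \<beta>" "\<beta> < 1/2"
    and \<alpha>: "0 \<le> \<alpha>" "\<alpha> \<le> 1"
    and eps_ok: "real K * \<epsilon> \<le> 1"
    and corr: "(\<Sum>t<T. \<integral>\<omega>. (MAX j\<in>{..<K}. \<bar>adv t \<omega> j - fst (\<omega> t) j\<bar>) \<partial>\<Omega>)
                 \<le> real K * real T powr \<beta>"
  shows "(\<integral>\<omega>. (\<Sum>t<T. fst (\<omega> t) (act K \<alpha> \<eta> \<epsilon> \<epsilon> adv t \<omega>)) \<partial>\<Omega>)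
           - real T * (MIN j\<in>{..<K}. \<mu> j)
         \<le> (if \<alpha> < 1/3
             then (2 * sqrt (real K) * ln (real T) + 2 * ln (real T) * real T powr \<beta>) * sqrt (real K * real T)
             else (4 * sqrt (real K) * ln (real K) + 2 * ln (real T) * real T powr \<beta>) * sqrt (real K * real T))"
proof -
  have T0: "0 < real T" and K0: "0 < real K" using K T by auto
  have \<epsilon>0: "0 < \<epsilon>" using T0 K0 by (simp add: \<epsilon>_def)
  have \<eta>0: "0 < \<eta>" using T0 by (simp add: \<eta>_def)
  interpret corrupted_bandit K T \<alpha> \<eta> \<epsilon> D adv \<Omega>
    by (rule corrupted_bandit.intro)
      (fact \<Omega>_def K D_prob D_sets D_range adv_causal adv_range[unfolded \<Omega>_def] adv_meas[unfolded \<Omega>_def]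
        \<alpha> \<eta>0 \<epsilon>0 eps_ok)+
  define G where "G = (\<integral>\<omega>. (\<Sum>t<T. fst (\<omega> t) (act K \<alpha> \<eta> \<epsilon> \<epsilon> adv t \<omega>)) \<partial>\<Omega>)"
  have "Min (\<mu> ` {..<K}) \<in> \<mu> ` {..<K}" using K by (intro Min_in) (auto simp: lessThan_empty_iff)
  then obtain a where a: "a < K" "(MIN j\<in>{..<K}. \<mu> j) = \<mu> a" by auto
  \<comment> \<open>After factoring out \<open>S\<close>, the square root of the horizon, only the
    brackets remain to be compared.\<close>
  define S k L P where "S = sqrt (real T)" and "k = real K" and "L = ln (real T)" and "P = real T powr \<beta>"
  have S1: "1 \<le> S" and S2: "S * S = real T" using T by (auto simp: S_def)
  have L: "L = 2 * ln S" "0 \<le> L" using T by (auto simp: L_def S_def ln_sqrt)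
  have k1: "1 \<le> k" using K by (simp add: k_def)
  have sk: "sqrt k * sqrt k = k" "1 \<le> sqrt k" using k1 by auto
  have P1: "1 \<le> P" using T \<beta> by (simp add: P_def ge_one_powr_ge_zero)
  have goal_rhs: "(2 * sqrt (real K) * ln (real T) + 2 * ln (real T) * real T powr \<beta>) * sqrt (real K * real T)
      = S * (2 * k * L + 2 * L * (P * sqrt k))"
    "(4 * sqrt (real K) * ln (real K) + 2 * ln (real T) * real T powr \<beta>) * sqrt (real K * real T)
      = S * (4 * k * ln k + 2 * L * (P * sqrt k))"
    using sk(1) by (simp_all add: S_def k_def L_def P_def real_sqrt_mult algebra_simps)
  have lnk: "0 \<le> ln k" "k - k * ln k \<le> 1"
  proof -
    have "1 - 1 / k \<le> ln k" using ln_le_minus_one[of "1 / k"] k1 by (simp add: ln_div)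
    then have "k * (1 - 1 / k) \<le> k * ln k" using k1 by (intro mult_left_mono) auto
    then show "k - k * ln k \<le> 1" using k1 by (simp add: right_diff_distrib)
  qed (use k1 in auto)
  have rhs_nonneg: "0 \<le> S * (2 * k * L + 2 * L * (P * sqrt k))" "0 \<le> S * (4 * k * ln k + 2 * L * (P * sqrt k))"
    using S1 k1 L P1 sk lnk by auto
  have "G - real T * \<mu> a \<le> S * (if \<alpha> < 1/3 then 2 * k * L + 2 * L * (P * sqrt k)
      else 4 * k * ln k + 2 * L * (P * sqrt k))"
  proof (cases "K = 1")
    \<comment> \<open>With one arm the regret is exactly 0. This case stands apart because for
      \<open>T = 1\<close> the claimed bound is 0 as well.\<close>
    case True
    have "act K \<alpha> \<eta> \<epsilon> \<epsilon> adv t \<omega> = 0" for t \<omega> using A_less[of t \<omega>] True by simp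
    then have "G = (\<Sum>t<T. \<integral>\<omega>. fst (\<omega> t) 0 \<partial>\<Omega>)"
      unfolding G_def using integrable_loss[of _ 0] True by (simp add: Bochner_Integration.integral_sum)
    also have "\<dots> = real T * \<mu> a" using expectation_loss[of _ 0] True a by (simp add: \<mu>_def)
    finally show ?thesis using rhs_nonneg by simp
  next
    case False
    then have k2: "2 \<le> k" using K by (simp add: k_def)
    have sk14: "7/5 \<le> sqrt k" using k2 by (intro real_le_rsqrt) (simp add: power2_eq_square)
    have \<epsilon>': "\<epsilon> = P / (sqrt k * S)"
      using T0 by (simp add: \<epsilon>_def P_def S_def k_def powr_diff powr_half_sqrt)
    \<comment> \<open>\<open>eps_ok\<close> in the new variables. It bounds the corruption term
      later and, with two arms or more, forces \<open>S\<close> to be at least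
      \<open>7/5\<close>.\<close>
    have kP: "sqrt k * P \<le> S"
    proof -
      have "k * P \<le> sqrt k * S" using eps_ok S1 sk k1 unfolding \<epsilon>' k_def[symmetric] by (simp add: field_simps)
      then have "sqrt k * (sqrt k * P) \<le> sqrt k * S" using sk by (simp add: mult.assoc[symmetric])
      then show ?thesis using sk by simp
    qed
    have "sqrt k * 1 \<le> sqrt k * P" using P1 sk by (intro mult_left_mono) auto
    then have S14: "7/5 \<le> S" using sk14 kP by linarith
    have kP28: "2 * L * (7/5) \<le> 2 * L * (P * sqrt k)"
      using L sk14 P1 mult_mono[of 1 P "7/5" "sqrt k"] by (intro mult_left_mono) auto
    have pos: "0 \<le> 2 * k * L" "0 \<le> 4 * k * ln k" using k2 L lnk by auto
    show ?thesis
    proof (cases "L < 4")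
      case True
      \<comment> \<open>For small horizons one summand of the claimed bracket already exceeds
        \<open>S\<close>, so the trivial bound \<open>T = S * S\<close> is enough.\<close>
      then have "S \<le> 2 * L * (7/5)" using le_mult_ln_if_small[OF S14] L by simp
      then have "S \<le> (if \<alpha> < 1/3 then 2 * k * L + 2 * L * (P * sqrt k) else 4 * k * ln k + 2 * L * (P * sqrt k))"
        using kP28 pos by - (split if_split, intro conjI impI, linarith+)
      then have "S * S \<le> S * (if \<alpha> < 1/3 then 2 * k * L + 2 * L * (P * sqrt k) else 4 * k * ln k + 2 * L * (P * sqrt k))"
        using S1 by (intro mult_left_mono) auto
      moreover have "G \<le> S * S" unfolding S2 G_def by (rule expected_loss_le_horizon)
      moreover have "0 \<le> real T * \<mu> a" using integral_mean_nonneg[OF a(1)] by (simp add: \<mu>_def)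
      ultimately show ?thesis by linarith
    next
      case False
      let ?u = "mixed_arm K \<epsilon> a"
      have u: "?u \<in> simplex_eps K \<epsilon>" using a(1) eps_ok by (rule mixed_arm_in_simplex_eps)
      define B where "B = (\<Sum>i<K. breg1 \<alpha> (?u i) (1 / real K))"
      \<comment> \<open>The logarithm is at most \<open>ln S = L / 2\<close>, and
        \<open>1 / (1 - \<alpha>)\<close> is at most \<open>3/2\<close>.\<close>
      have B1: "B \<le> 3/4 * (k * L)" if "\<alpha> < 1/3"
      proof -
        have "B \<le> k * (- ln (k * \<epsilon>)) / (1 - \<alpha>)"
          unfolding B_def k_def using that \<alpha> \<epsilon>0 K eps_ok by (intro breg1_uniform_le_ln_eps u) auto
        also have "k * \<epsilon> = (sqrt k * P) / S" using sk k1 S1 unfolding \<epsilon>' by (simp add: field_simps)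
        also have "- ln (sqrt k * P / S) = ln S - ln (sqrt k * P)"
          using sk P1 S1 by (simp add: ln_div)
        also have "k * (ln S - ln (sqrt k * P)) / (1 - \<alpha>) \<le> (k * (L / 2)) / (2 / 3)"
        proof (intro frac_le mult_left_mono)
          have "1 \<le> sqrt k * P" using sk P1 mult_mono[of 1 "sqrt k" 1 P] by simp
          then have "0 \<le> ln (sqrt k * P)" by simp
          then show "ln S - ln (sqrt k * P) \<le> L / 2" using L by simp
        qed (use that k1 L in auto)
        finally show ?thesis by simp
      qed
      have B2: "B \<le> 3 * k * ln k" if "1/3 \<le> \<alpha>"
        unfolding B_def k_def using that \<alpha> \<epsilon>0 K by (intro breg1_uniform_le_ln_dim[OF u]) auto
      have "G - real T * \<mu> a \<le> B / \<eta> + real T * (2 * (real K - 1) * \<epsilon> + \<eta> * (3 + real K))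
          + 2 * (\<Sum>t<T. \<integral>\<omega>. corruption t \<omega> \<partial>\<Omega>)"
        unfolding G_def \<mu>_def B_def by (rule expected_regret_le[OF a(1) order_refl])
      also have "\<dots> \<le> B / \<eta> + real T * (2 * real K * \<epsilon> + \<eta> * (3 + real K)) + 2 * (real K * P)"
        using corr \<epsilon>0 T0 unfolding P_def by (intro add_mono mult_left_mono mult_right_mono) auto
      also have "\<dots> = S * (B + 2 * (P * sqrt k) + (3 + k)) + 2 * (sqrt k * (sqrt k * P))"
      proof -
        have "\<eta> = 1 / S" by (simp add: \<eta>_def S_def)
        moreover have "real T * (2 * real K * \<epsilon>) = S * (2 * (P * sqrt k))"
          using sk k1 S1 unfolding \<epsilon>' S2[symmetric] k_def[symmetric] by (simp add: field_simps)
        moreover have "real T * (1 / S * (3 + real K)) = S * (3 + k)"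
          using S1 unfolding S2[symmetric] k_def by simp
        ultimately show ?thesis using S1 sk by (simp add: k_def distrib_left mult.assoc[symmetric])
      qed
      \<comment> \<open>By \<open>kP\<close> the corruption term, too, becomes a multiple of
        \<open>S\<close>.\<close>
      also have "\<dots> \<le> S * (B + 2 * (P * sqrt k) + (3 + k)) + 2 * (sqrt k * S)"
        using kP sk P1 S1 by (intro add_mono mult_left_mono) auto
      also have "\<dots> = S * (B + 2 * (P * sqrt k) + (3 + k) + 2 * sqrt k)"
        by (simp add: algebra_simps)
      also have "\<dots> \<le> S * (if \<alpha> < 1/3 then 2 * k * L + 2 * L * (P * sqrt k)
          else 4 * k * ln k + 2 * L * (P * sqrt k))"
      proof (intro mult_left_mono)
        have Pk: "sqrt k \<le> P * sqrt k" using P1 sk mult_right_mono[of 1 P "sqrt k"] by simp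
        have LP: "8 * (P * sqrt k) \<le> 2 * L * (P * sqrt k)"
          using False P1 sk by (intro mult_right_mono) auto
        have kL: "4 * k \<le> k * L" using False k1 by (simp add: mult.commute)
        show "B + 2 * (P * sqrt k) + (3 + k) + 2 * sqrt k \<le>
          (if \<alpha> < 1/3 then 2 * k * L + 2 * L * (P * sqrt k) else 4 * k * ln k + 2 * L * (P * sqrt k))"
        proof (cases "\<alpha> < 1/3")
          case True
          \<comment> \<open>\<open>B\<close> leaves \<open>5/4 * (k * L)\<close>, at least
            \<open>5 * k\<close>, which absorbs \<open>3 + k\<close>; the other terms are at most
            \<open>4 * (P * sqrt k)\<close>.\<close>
          show ?thesis unfolding if_P[OF True] using B1[OF True] Pk LP kL k2 sk by linarith
        next
          case False
          then have "1/3 \<le> \<alpha>" by simp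
          \<comment> \<open>The spare \<open>k * ln k\<close> reduces \<open>k\<close> to at most 1.
            What remains, \<open>4 + 2 * (P * sqrt k) + 2 * sqrt k\<close>, is at most
            \<open>8 * (P * sqrt k)\<close>.\<close>
          from B2[OF this] show ?thesis unfolding if_not_P[OF False] using Pk LP lnk sk by linarith
        qed
      qed (use S1 in auto)
      finally show ?thesis .
    qed
  qed
  then show ?thesis unfolding goal_rhs a(2) G_def by (simp split: if_splits)
qed

end
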